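(* For every $k\geq 2$, the Weisfeiler--Leman dimension of the graph invariant $G\mapsto\#\mathrm{IndSub}(\Phi_{\mathsf{even}}^{(k)}\to G)$ is equal to $\lfloor k/2\rfloor$.
   Context: All graphs are finite, simple and undirected. $\Phi_{\mathsf{even}}^{(k)}(G)=1$ if $|V(G)|=k$ and every vertex of $G$ has even degree, and $0$ otherwise; $\#\mathrm{IndSub}(\Phi_{\mathsf{even}}^{(k)}\to G)=\sum_{X\subseteq V(G)}\Phi_{\mathsf{even}}^{(k)}(G[X])$. For graphs $F,G$, $\hom(F,G)$ is the number of homomorphisms from $F$ to $G$. For $d\ge1$, the $d$-dimensional Weisfeiler--Leman algorithm distinguishes graphs $G,G'$ if and only if $\hom(F,G)\neq\hom(F,G')$ for some graph $F$ of tree-width at most $d$. The Weisfeiler--Leman dimension of a graph invariant $f$ is the minimal $d\geq1$ such that $d$-WL distinguishes all pairs $G,G'$ with $f(G)\neq f(G')$. *)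

theory Defs
  imports
    "Graph_Theory.Graph_Theory"
    "HOL-Library.Extended_Nat"
    "HOL-Library.FuncSet"
begin

text \<open>
  A finite simple undirected graph is a \<open>G\<close> with \<open>pair_graph G\<close>: a finite, loopfree digraph
  whose arc set \<open>parcs G\<close> is symmetric, so that the edge \<open>uv\<close> is represented by the two arcs
  \<open>(u, v)\<close> and \<open>(v, u)\<close>. The constant \<open>with_proj\<close> only turns such a pair digraph into a general
  digraph.
\<close>

text \<open>In a symmetric digraph the out-degree of a vertex is its undirected degree.\<close>

definition Phi_even :: "nat \<Rightarrow> ('a, 'b) pre_digraph \<Rightarrow> nat" where
  "Phi_even k H =
    (if card (verts H) = k \<and> (\<forall>v \<in> verts H. even (out_degree H v)) then 1 else 0)"

definition num_indsub :: "(('a, 'a \<times> 'a) pre_digraph \<Rightarrow> nat) \<Rightarrow> 'a pair_pre_digraph \<Rightarrow> nat" where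
  "num_indsub \<Phi> G = (\<Sum>X \<in> Pow (pverts G). \<Phi> (with_proj G \<restriction> X))"

text \<open>Extensional functions, so that a homomorphism is determined by its values on \<open>pverts F\<close>.\<close>

definition graph_homs :: "'a pair_pre_digraph \<Rightarrow> 'b pair_pre_digraph \<Rightarrow> ('a \<Rightarrow> 'b) set" where
  "graph_homs F G =
    {h \<in> pverts F \<rightarrow>\<^sub>E pverts G. \<forall>(u, v) \<in> parcs F. (h u, h v) \<in> parcs G}"

definition hom_count :: "'a pair_pre_digraph \<Rightarrow> 'b pair_pre_digraph \<Rightarrow> nat" where
  "hom_count F G = card (graph_homs F G)"

text \<open>
  The library's \<open>tree\<close> is a notion for directed graphs: there the two arcs of an undirected edge
  already form a cycle of length 2. The cycles of an undirected graph are those of length at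
  least 3. The library's \<open>connected\<close> includes non-emptiness.
\<close>

definition undirected_tree :: "'a pair_pre_digraph \<Rightarrow> bool" where
  "undirected_tree T \<longleftrightarrow>
    pair_graph T \<and> connected (with_proj T) \<and>
    \<not> (\<exists>p. pre_digraph.cycle (with_proj T) p \<and> length p \<ge> 3)"

definition tree_decomposition ::
    "'a pair_pre_digraph \<Rightarrow> 't pair_pre_digraph \<Rightarrow> ('t \<Rightarrow> 'a set) \<Rightarrow> bool" where
  "tree_decomposition G T B \<longleftrightarrow>
    undirected_tree T \<and>
    (\<Union>t \<in> pverts T. B t) = pverts G \<and>
    (\<forall>(u, v) \<in> parcs G. \<exists>t \<in> pverts T. u \<in> B t \<and> v \<in> B t) \<and>
    (\<forall>v \<in> pverts G. connected (with_proj T \<restriction> {t \<in> pverts T. v \<in> B t}))"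

definition decomposition_width :: "'t pair_pre_digraph \<Rightarrow> ('t \<Rightarrow> 'a set) \<Rightarrow> nat" where
  "decomposition_width T B = Max ((\<lambda>t. card (B t)) ` pverts T) - 1"

text \<open>
  Every finite tree is isomorphic to one with vertices in \<open>nat\<close>, so this type suffices for the
  index trees. Because of truncated subtraction the empty graph gets tree-width 0 rather than -1,
  which is irrelevant for bounds by some \<open>d \<ge> 1\<close>.
\<close>

definition treewidth :: "'a pair_pre_digraph \<Rightarrow> nat" where
  "treewidth G =
    (LEAST w. \<exists>(T :: nat pair_pre_digraph) B.
       tree_decomposition G T B \<and> decomposition_width T B = w)"

text \<open>
  The Weisfeiler--Leman algorithm enters through its characterisation by homomorphism counts,
  for \<open>d \<ge> 1\<close>. Again, \<open>nat\<close> suffices as vertex type since all graphs are finite.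
\<close>

definition WL_distinguishes :: "nat \<Rightarrow> 'a pair_pre_digraph \<Rightarrow> 'b pair_pre_digraph \<Rightarrow> bool" where
  "WL_distinguishes d G G' \<longleftrightarrow>
    (\<exists>F :: nat pair_pre_digraph.
       pair_graph F \<and> treewidth F \<le> d \<and> hom_count F G \<noteq> hom_count F G')"

text \<open>The infimum in \<open>enat\<close> is the minimum if some \<open>d\<close> qualifies, and \<open>\<infinity>\<close> otherwise.\<close>

definition WL_dimension :: "(nat pair_pre_digraph \<Rightarrow> 'c) \<Rightarrow> enat" where
  "WL_dimension f =
    Inf {enat d | d. d \<ge> 1 \<and>
      (\<forall>G G'. pair_graph G \<longrightarrow> pair_graph G' \<longrightarrow> f G \<noteq> f G' \<longrightarrow> WL_distinguishes d G G')}"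

end

theory Submission
  imports Defs
begin

text \<open>
  Upper bound: the indicator of even degrees on \<open>k\<close> vertices is the average over all subsets \<open>S\<close>
  of the sign \<open>(-1)\<close> to the number of edges leaving \<open>S\<close>. Expanding this product expresses the
  invariant through numbers of embeddings of subgraphs of complete bipartite graphs on \<open>k\<close>
  vertices, and these through homomorphism counts from quotients, all of which have a vertex
  cover, hence tree-width, of at most \<open>k div 2\<close>.

  Lower bound: for \<open>c = k div 2\<close>, the twisted and the untwisted Cai-Fuerer-Immerman graph over
  \<open>K(c, k - c)\<close> have equal homomorphism counts from every graph of tree-width less than \<open>c\<close>: a
  tree decomposition allows moving the twist away from every bag. Yet a transversal of the colour
  classes inducing only even degrees has an even number of edges, by bipartiteness, while in the
  twisted graph every transversal has an odd number.
\<close>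

section \<open>Graphs, trees and tree-width\<close>

lemma pair_graphI:
  assumes "finite (pverts G)" "parcs G \<subseteq> pverts G \<times> pverts G" "sym (parcs G)" "irrefl (parcs G)"
  shows "pair_graph G"
proof
  show "finite (parcs G)"
    using assms(1,2) by (meson finite_SigmaI finite_subset)
  show "symmetric (with_proj G)"
    using assms(3) by (simp add: symmetric_def)
  show "\<And>e. e \<in> parcs G \<Longrightarrow> fst e \<noteq> snd e"
    using assms(4) by (auto simp: irrefl_def)
qed (use assms in auto)

lemma pair_graphD:
  assumes "pair_graph G"
  shows "finite (pverts G)" "parcs G \<subseteq> pverts G \<times> pverts G" "sym (parcs G)" "irrefl (parcs G)"
proof -
  interpret pair_graph G by fact
  show "finite (pverts G)" "parcs G \<subseteq> pverts G \<times> pverts G" "sym (parcs G)" "irrefl (parcs G)"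
    using pair_finite_verts in_arcsD1 in_arcsD2 arcs_symmetric no_loops'
    by (auto simp: irrefl_def intro!: symI) metis
qed

lemma num_indsub_even_conv:
  assumes "pair_graph G"
  shows "num_indsub (Phi_even k) G =
    card {X. X \<subseteq> pverts G \<and> card X = k \<and> (\<forall>v\<in>X. even (card {w\<in>X. (v, w) \<in> parcs G}))}"
proof -
  have fin: "finite (Pow (pverts G))"
    using pair_graphD[OF assms] by simp
  have deg: "out_degree (with_proj G \<restriction> X) v = card {w\<in>X. (v, w) \<in> parcs G}" if "v \<in> X" for X v
  proof -
    have "out_arcs (with_proj G \<restriction> X) v = Pair v ` {w\<in>X. (v, w) \<in> parcs G}"
      using that by (auto simp: out_arcs_def induce_subgraph_def)
    then show ?thesis
      by (simp add: out_degree_def card_image inj_on_def)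
  qed
  have "num_indsub (Phi_even k) G =
    (\<Sum>X\<in>Pow (pverts G).
      if card X = k \<and> (\<forall>v\<in>X. even (card {w\<in>X. (v, w) \<in> parcs G})) then 1 else 0)"
    unfolding num_indsub_def Phi_even_def
    by (rule sum.cong) (auto simp: deg)
  also have "\<dots> = card {X \<in> Pow (pverts G).
      card X = k \<and> (\<forall>v\<in>X. even (card {w\<in>X. (v, w) \<in> parcs G}))}"
    using fin by (simp add: sum.If_cases Int_def)
  finally show ?thesis
    by simp
qed

lemma connected_induced_conv:
  "connected (with_proj T \<restriction> I) \<longleftrightarrow>
    I \<noteq> {} \<and> (\<forall>u\<in>I. \<forall>v\<in>I. (u, v) \<in> rtrancl_on I ((parcs T \<inter> I \<times> I)\<^sup>s))"
proof -
  have "arcs_ends (with_proj T \<restriction> I) = parcs T \<inter> I \<times> I"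
    by (auto simp: arcs_ends_conv induce_subgraph_def image_iff)
  then show ?thesis
    by (simp add: connected_conv)
qed

lemma undirected_treeD:
  assumes "undirected_tree T"
  shows "pair_graph T" "pverts T \<noteq> {}" "finite (pverts T)"
  using assms pair_graphD[of T]
  by (auto simp: undirected_tree_def connected_conv)

text \<open>
  Grow a maximal subtree on which a consistent choice exists: a new vertex attached to it has
  only one neighbour in it, since two of them would close a cycle.
\<close>

lemma tree_choice:
  assumes T: "undirected_tree T"
    and base: "\<And>t. t \<in> pverts T \<Longrightarrow> \<exists>s. P t s"
    and step: "\<And>t t' s. (t, t') \<in> parcs T \<Longrightarrow> P t s \<Longrightarrow> \<exists>s'. P t' s' \<and> R t t' s s'"
    and sym: "\<And>t t' s s'. R t t' s s' \<Longrightarrow> R t' t s' s"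
  shows "\<exists>f. (\<forall>t\<in>pverts T. P t (f t)) \<and> (\<forall>(t, t')\<in>parcs T. R t t' (f t) (f t'))"
proof -
  interpret pair_graph T
    using undirected_treeD[OF T] by simp
  \<comment> \<open>\<open>linked\<close> asks for simple paths that stay inside \<open>U\<close>:
    such a path between two neighbours of a vertex outside \<open>U\<close> closes up to a cycle
    through this vertex that meets it only once.\<close>
  define linked where "linked U \<longleftrightarrow>
      (\<forall>u\<in>U. \<forall>v\<in>U. \<exists>p. apath u p v \<and> set (awalk_verts u p) \<subseteq> U)" for U
  define good where "good U f \<longleftrightarrow>
      (\<forall>t\<in>U. P t (f t)) \<and> (\<forall>(t, t')\<in>parcs T. t \<in> U \<longrightarrow> t' \<in> U \<longrightarrow> R t t' (f t) (f t'))" for U f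
  define \<U> where "\<U> = {U. U \<subseteq> pverts T \<and> U \<noteq> {} \<and> linked U \<and> (\<exists>f. good U f)}"
  obtain t0 where t0: "t0 \<in> pverts T"
    using undirected_treeD[OF T] by blast
  have "{t0} \<in> \<U>"
  proof -
    obtain s where "P t0 s"
      using base[OF t0] by blast
    then have "good {t0} (\<lambda>_. s)"
      using no_loops' by (auto simp: good_def)
    moreover have "linked {t0}"
      using t0 by (auto simp: linked_def apath_Nil_iff intro!: exI[of _ "[]"])
    ultimately show ?thesis
      using t0 by (auto simp: \<U>_def)
  qed
  moreover have "finite \<U>"
    using pair_finite_verts by (auto simp: \<U>_def)
  ultimately obtain U where U: "U \<in> \<U>" and max: "\<And>U'. U' \<in> \<U> \<Longrightarrow> U \<subseteq> U' \<Longrightarrow> U = U'"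
    using finite_has_maximal[of \<U>] by (metis empty_iff)
  have "U = pverts T"
  proof (rule ccontr)
    assume "U \<noteq> pverts T"
    then obtain v u0 where v: "v \<in> pverts T" "v \<notin> U" and u0: "u0 \<in> U" "u0 \<in> pverts T"
      using U by (auto simp: \<U>_def)
    have "(u0, v) \<in> rtrancl_on (pverts T) ((parcs T)\<^sup>s)"
      using T u0 v by (auto simp: undirected_tree_def connected_conv)
    \<comment> \<open>A walk that starts in \<open>U\<close> and ends outside must cross the
      boundary of \<open>U\<close>.\<close>
    then have "v \<in> U \<or> (\<exists>u\<in>U. \<exists>t. t \<notin> U \<and> (u, t) \<in> parcs T)"
    proof (induction rule: rtrancl_on_induct)
      case base
      then show ?case using u0 by simp
    next
      case (step y z)
      then show ?case
        using arcs_symmetric by (auto simp: symcl_def)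
    qed
    then obtain u t where ut: "u \<in> U" "t \<notin> U" "(u, t) \<in> parcs T"
      using v by blast
    have tu: "(t, u) \<in> parcs T" and tT: "t \<in> pverts T"
      using arcs_symmetric in_arcsD2 ut by blast+
    obtain f where f: "good U f" and lU: "linked U" and sU: "U \<subseteq> pverts T"
      using U by (auto simp: \<U>_def)
    obtain s where s: "P t s" "R u t (f u) s"
      using step[OF ut(3), of "f u"] f ut by (auto simp: good_def)
    have unique: "u' = u" if u': "u' \<in> U" "(u', t) \<in> parcs T" for u'
    proof (rule ccontr)
      assume "u' \<noteq> u"
      obtain p where p: "apath u p u'" "set (awalk_verts u p) \<subseteq> U"
        using lU ut u' unfolding linked_def by blast
      have "p \<noteq> []"
        using p \<open>u' \<noteq> u\<close> by (auto simp: apath_Nil_iff)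
      have p': "awalk u p u'" "distinct (awalk_verts u p)"
        using p by (auto simp: apath_def)
      have end_arc: "awalk u' [(u', t)] t"
        using u' tT by (simp add: awalk_simps)
      have walk: "awalk u (p @ [(u', t)]) t"
        using p'(1) end_arc by (rule awalk_appendI)
      have verts: "awalk_verts u (p @ [(u', t)]) = awalk_verts u p @ [t]"
        using awalk_verts_append[OF walk] p'(1) by auto
      have "awalk t ((t, u) # p @ [(u', t)]) t"
        using walk tu unfolding awalk_Cons_iff fst_conv snd_conv by blast
      moreover have "distinct (tl (awalk_verts t ((t, u) # p @ [(u', t)])))"
        using verts p'(2) p(2) ut(2) by auto
      ultimately have "cycle ((t, u) # p @ [(u', t)])"
        unfolding cycle_def by blast
      \<comment> \<open>\<open>p\<close> is nonempty because \<open>u'\<close> differs from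
        \<open>u\<close>; going back and forth along one edge would only give length 2.\<close>
      moreover have "length ((t, u) # p @ [(u', t)]) \<ge> 3"
        using \<open>p \<noteq> []\<close> by (cases p) auto
      ultimately show False
        using T unfolding undirected_tree_def by blast
    qed
    have "good (insert t U) (f(t := s))"
    proof -
      have "R t' t'' ((f(t := s)) t') ((f(t := s)) t'')"
        if "(t', t'') \<in> parcs T" "t' \<in> insert t U" "t'' \<in> insert t U" for t' t''
      proof (cases "t' = t")
        case True
        then have "t'' = u"
          using that unique arcs_symmetric no_loops' by blast
        then show ?thesis
          using True s(2) ut sym by auto
      next
        case False
        show ?thesis
        proof (cases "t'' = t")
          case True
          then have "t' = u"
            using that unique False by blast
          then show ?thesis
            using True s(2) ut by auto
        next
          case False
          then show ?thesis
            using \<open>t' \<noteq> t\<close> that f by (auto simp: good_def)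
        qed
      qed
      moreover have "P t' ((f(t := s)) t')" if "t' \<in> insert t U" for t'
        using that s(1) f by (auto simp: good_def)
      ultimately show ?thesis
        unfolding good_def by blast
    qed
    moreover have "linked (insert t U)"
    proof -
      have out: "\<exists>p. apath t p w \<and> set (awalk_verts t p) \<subseteq> insert t U" if w: "w \<in> U" for w
      proof -
        obtain p where p: "apath u p w" "set (awalk_verts u p) \<subseteq> U"
          using lU ut w unfolding linked_def by blast
        then have "apath t ((t, u) # p) w" "set (awalk_verts t ((t, u) # p)) \<subseteq> insert t U"
          using tu ut(2) by (auto simp: apath_Cons_iff)
        then show ?thesis by blast
      qed
      have inw: "\<exists>p. apath w p t \<and> set (awalk_verts w p) \<subseteq> insert t U" if w: "w \<in> U" for w
      proof -
        obtain p where p: "apath t p w" "set (awalk_verts t p) \<subseteq> insert t U"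
          using out[OF w] by blast
        then have "awalk t p w"
          by (simp add: apath_def)
        then have "set (awalk_verts w (rev_path p)) \<subseteq> insert t U"
          using p(2) awalk_verts_rev_path by fastforce
        moreover have "apath w (rev_path p) t"
          using p(1) by simp
        ultimately show ?thesis by blast
      qed
      have self: "\<exists>p. apath t p t \<and> set (awalk_verts t p) \<subseteq> insert t U"
        using tT by (auto simp: apath_Nil_iff intro!: exI[of _ "[]"])
      have "\<exists>p. apath w p w' \<and> set (awalk_verts w p) \<subseteq> insert t U" if "w \<in> U" "w' \<in> U" for w w'
        using lU that unfolding linked_def by blast
      then show ?thesis
        using out inw self unfolding linked_def by blast
    qed
    ultimately have "insert t U \<in> \<U>"
      using sU tT by (auto simp: \<U>_def)
    then show False
      using max[of "insert t U"] ut by blast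
  qed
  then obtain f where f: "good (pverts T) f"
    using U by (auto simp: \<U>_def)
  then have "\<forall>(t, t')\<in>parcs T. R t t' (f t) (f t')"
    using in_arcsD1 in_arcsD2 by (fastforce simp: good_def)
  then show ?thesis
    using f by (auto simp: good_def)
qed

text \<open>The decomposition is a star with centre bag \<open>C\<close>.\<close>

lemma treewidth_le_vertex_cover:
  fixes F :: "nat pair_pre_digraph"
  assumes F: "pair_graph F" and C: "C \<subseteq> pverts F"
    and cover: "\<And>u v. (u, v) \<in> parcs F \<Longrightarrow> u \<in> C \<or> v \<in> C"
  shows "treewidth F \<le> card C"
    and "\<exists>(T :: nat pair_pre_digraph) B. tree_decomposition F T B"
proof -
  note F' = pair_graphD[OF F]
  \<comment> \<open>\<open>0\<close> is the centre and \<open>Suc v\<close> the leaf of the vertex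
    \<open>v\<close>, with bag \<open>insert v C\<close>.\<close>
  define T :: "nat pair_pre_digraph" where
    "T = \<lparr>pverts = insert 0 (Suc ` pverts F),
          parcs = {0} \<times> Suc ` pverts F \<union> Suc ` pverts F \<times> {0}\<rparr>"
  define B where "B t = (case t of 0 \<Rightarrow> C | Suc v \<Rightarrow> insert v C)" for t
  have B [simp]: "B 0 = C" "B (Suc v) = insert v C" for v
    by (auto simp: B_def)
  have B_ge: "C \<subseteq> B t" for t
    by (cases t) auto
  have graph: "pair_graph T"
    by (rule pair_graphI) (auto simp: T_def F' intro!: symI simp: irrefl_def)
  have star: "connected (with_proj T)"
  proof -
    let ?r = "(parcs T)\<^sup>s" and ?V = "pverts T"
    have to0: "(u, 0) \<in> rtrancl_on ?V ?r" "(0, u) \<in> rtrancl_on ?V ?r" if "u \<in> ?V" for u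
    proof -
      have z: "(0, 0) \<in> rtrancl_on ?V ?r" "(u, u) \<in> rtrancl_on ?V ?r"
        using that by (auto simp: T_def)
      have "u = 0 \<or> (u, 0) \<in> ?r \<and> (0, u) \<in> ?r"
        using that by (auto simp: T_def symcl_def)
      then show "(u, 0) \<in> rtrancl_on ?V ?r" "(0, u) \<in> rtrancl_on ?V ?r"
        using z that rtrancl_on_into_rtrancl_on[of u u ?V ?r 0]
          rtrancl_on_into_rtrancl_on[of 0 0 ?V ?r u] by (auto simp: T_def)
    qed
    then have "(u, v) \<in> rtrancl_on ?V ?r" if "u \<in> ?V" "v \<in> ?V" for u v
      using that rtrancl_on_trans[of u 0 ?V ?r v] by blast
    moreover have "?V \<noteq> {}"
      by (simp add: T_def)
    ultimately show ?thesis
      unfolding connected_conv with_proj_simps by blast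
  qed
  have acyc: "\<not> (\<exists>p. pre_digraph.cycle (with_proj T) p \<and> length p \<ge> 3)"
  proof clarify
    fix p assume p: "pre_digraph.cycle (with_proj T) p" "length p \<ge> 3"
    then obtain e1 e2 e3 q where q: "p = e1 # e2 # e3 # q"
      by (metis Suc_le_length_iff numeral_3_eq_3)
    interpret T: pair_graph T by (rule graph)
    obtain u where u: "T.awalk u p u" "distinct (tl (T.awalk_verts u p))"
      using p(1) by (auto simp: T.cycle_def)
    obtain a b b' c c' d where e: "e1 = (a, b)" "e2 = (b', c)" "e3 = (c', d)"
      by (meson surj_pair)
    have eqs: "a = u" "b' = b" "c' = c" and arcs: "(a, b) \<in> parcs T" "(b, c) \<in> parcs T" "(c, d) \<in> parcs T"
      and w: "T.awalk d q u"
      using u(1) unfolding q e T.awalk_Cons_iff fst_conv snd_conv by blast+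
    have dist: "distinct (b # c # T.awalk_verts d q)"
      using u(2) unfolding q e eqs by simp
    have "last (T.awalk_verts d q) = u"
      using w unfolding T.awalk_conv by blast
    then have "d \<in> set (T.awalk_verts d q)" "u \<in> set (T.awalk_verts d q)"
      using T.hd_in_awalk_verts(1)[OF w] last_in_set[OF T.awalk_verts_non_Nil, of d q] by auto
    \<comment> \<open>Every arc of the star has exactly one end \<open>0\<close>, so along the walk
      \<open>u\<close>, \<open>b\<close>, \<open>c\<close>, \<open>d\<close> either \<open>u\<close>
      and \<open>c\<close> or \<open>b\<close> and \<open>d\<close> are both
      \<open>0\<close>.\<close>
    then have "b \<noteq> d" "c \<noteq> u"
      using dist by auto
    then show False
      using arcs eqs by (auto simp: T_def)
  qed
  have tree: "undirected_tree T"
    using graph star acyc by (simp add: undirected_tree_def)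
  have inC: "{t \<in> pverts T. v \<in> B t} = pverts T" if "v \<in> C" for v
    using that B_ge by blast
  have notC: "{t \<in> pverts T. v \<in> B t} = {Suc v}" if "v \<in> pverts F" "v \<notin> C" for v
    using that by (auto simp: T_def)
  have "connected (with_proj T \<restriction> {t \<in> pverts T. v \<in> B t})" if "v \<in> pverts F" for v
  proof (cases "v \<in> C")
    case True
    have "parcs T \<inter> pverts T \<times> pverts T = parcs T"
      using pair_graphD[OF graph] by blast
    then show ?thesis
      using star unfolding inC[OF True] connected_induced_conv unfolding connected_conv by simp
  next
    case False
    show ?thesis
      unfolding notC[OF that False] connected_induced_conv by auto
  qed
  moreover have "(\<Union>t\<in>pverts T. B t) = pverts F"
    using C by (auto simp: T_def)
  moreover have "\<exists>t\<in>pverts T. u \<in> B t \<and> v \<in> B t" if "(u, v) \<in> parcs F" for u v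
    using cover[OF that] F'(2) that by (auto simp: T_def)
  ultimately have dec: "tree_decomposition F T B"
    using tree by (auto simp: tree_decomposition_def)
  then show "\<exists>(T :: nat pair_pre_digraph) B. tree_decomposition F T B"
    by blast
  have finC: "finite C"
    using C F' finite_subset by blast
  \<comment> \<open>A leaf bag exceeds \<open>C\<close> by at most one vertex, which the subtraction
    in the width takes back.\<close>
  have "card (B t) \<le> Suc (card C)" for t
    using finC by (cases t) (auto simp: card_insert_if)
  then have "Max ((\<lambda>t. card (B t)) ` pverts T) \<le> Suc (card C)"
    by (subst Max_le_iff) (auto simp: T_def F')
  then have "decomposition_width T B \<le> card C"
    by (simp add: decomposition_width_def)
  moreover have "treewidth F \<le> decomposition_width T B"
    unfolding treewidth_def using dec by (intro Least_le) blast
  ultimately show "treewidth F \<le> card C"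
    by simp
qed

text \<open>The star whose centre bag is the whole vertex set is a decomposition, so the minimum is
  taken over a nonempty set and is attained.\<close>

lemma treewidth_decomposition:
  fixes F :: "nat pair_pre_digraph"
  assumes "pair_graph F"
  obtains T :: "nat pair_pre_digraph" and B
  where "tree_decomposition F T B" "decomposition_width T B = treewidth F"
proof -
  have "\<exists>w. \<exists>(T :: nat pair_pre_digraph) B. tree_decomposition F T B \<and> decomposition_width T B = w"
    using treewidth_le_vertex_cover(2)[OF assms subset_refl] pair_graphD(2)[OF assms] by blast
  from LeastI_ex[OF this] show thesis
    using that unfolding treewidth_def by blast
qed

section \<open>Upper bound\<close>

text \<open>These interpolate between homomorphisms, with \<open>D\<close> empty, and injective
  homomorphisms, with all pairs of distinct elements in \<open>D\<close>. An edge may appear in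
  \<open>E\<close> in one direction only.\<close>

definition constrained_maps ::
    "'a set \<Rightarrow> ('a \<times> 'a) set \<Rightarrow> ('a \<times> 'a) set \<Rightarrow> 'b pair_pre_digraph \<Rightarrow> ('a \<Rightarrow> 'b) set" where
  "constrained_maps V E D G = {\<phi> \<in> V \<rightarrow>\<^sub>E pverts G.
    (\<forall>(i, j)\<in>E. (\<phi> i, \<phi> j) \<in> parcs G) \<and> (\<forall>(i, j)\<in>D. \<phi> i \<noteq> \<phi> j)}"

lemma constrained_mapsI:
  assumes "\<phi> \<in> V \<rightarrow>\<^sub>E pverts G"
    and "\<And>i j. (i, j) \<in> E \<Longrightarrow> (\<phi> i, \<phi> j) \<in> parcs G"
    and "\<And>i j. (i, j) \<in> D \<Longrightarrow> \<phi> i \<noteq> \<phi> j"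
  shows "\<phi> \<in> constrained_maps V E D G"
  using assms by (auto simp: constrained_maps_def)

lemma constrained_mapsD:
  assumes "\<phi> \<in> constrained_maps V E D G"
  shows "\<phi> \<in> V \<rightarrow>\<^sub>E pverts G"
    and "(i, j) \<in> E \<Longrightarrow> (\<phi> i, \<phi> j) \<in> parcs G"
    and "(i, j) \<in> D \<Longrightarrow> \<phi> i \<noteq> \<phi> j"
  using assms by (auto simp: constrained_maps_def)

lemma finite_constrained_maps:
  assumes "pair_graph G" "finite V"
  shows "finite (constrained_maps V E D G)"
proof (rule finite_subset)
  show "constrained_maps V E D G \<subseteq> V \<rightarrow>\<^sub>E pverts G"
    by (auto simp: constrained_maps_def)
  show "finite (V \<rightarrow>\<^sub>E pverts G)"
    using assms pair_graphD(1) by (auto intro: finite_PiE)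
qed

text \<open>Deletion and contraction: a map either separates \<open>a\<close> and \<open>b\<close>,
  which is one more disequality, or identifies them and so factors through \<open>m\<close>, which
  merges \<open>b\<close> into \<open>a\<close>.\<close>

lemma card_constrained_maps_split:
  fixes V :: "'a set" and a b :: 'a
  defines "m \<equiv> \<lambda>i. if i = b then a else i"
  assumes G: "pair_graph G" and V: "finite V" and ab: "a \<in> V" "b \<in> V" "a \<noteq> b"
    and E: "E \<subseteq> V \<times> V" and D: "D \<subseteq> V \<times> V"
  shows "card (constrained_maps V E D G) =
    card (constrained_maps V E (insert (a, b) D) G) +
    card (constrained_maps (V - {b}) (map_prod m m ` E) (map_prod m m ` D) G)"
proof -
  let ?eq = "{\<phi> \<in> constrained_maps V E D G. \<phi> a = \<phi> b}"
  have split: "constrained_maps V E D G = constrained_maps V E (insert (a, b) D) G \<union> ?eq"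
    by (auto simp: constrained_maps_def)
  have "constrained_maps V E (insert (a, b) D) G \<inter> ?eq = {}"
    by (auto simp: constrained_maps_def)
  then have "card (constrained_maps V E D G) =
      card (constrained_maps V E (insert (a, b) D) G) + card ?eq"
    using finite_constrained_maps[OF G V] by (subst split, subst card_Un_disjoint) auto
  moreover have "bij_betw (\<lambda>\<phi>. restrict \<phi> (V - {b})) ?eq
      (constrained_maps (V - {b}) (map_prod m m ` E) (map_prod m m ` D) G)"
  \<comment> \<open>Restriction forgets the value at \<open>b\<close>; composition with
    \<open>m\<close> restores it as the value at \<open>a\<close>.\<close>
  proof (rule bij_betwI[where g = "\<lambda>\<psi>. restrict (\<psi> \<circ> m) V"])
    have m: "m i \<in> V - {b}" if "i \<in> V" for i
      using that ab by (auto simp: m_def)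
    show "(\<lambda>\<phi>. restrict \<phi> (V - {b})) \<in> ?eq \<rightarrow>
        constrained_maps (V - {b}) (map_prod m m ` E) (map_prod m m ` D) G"
    proof
      fix \<phi> assume "\<phi> \<in> ?eq"
      then have \<phi>: "\<phi> \<in> constrained_maps V E D G" and eq: "\<phi> a = \<phi> b"
        by auto
      have res: "restrict \<phi> (V - {b}) (m i) = \<phi> i" if "i \<in> V" for i
        using m[OF that] eq by (auto simp: m_def)
      show "restrict \<phi> (V - {b}) \<in>
          constrained_maps (V - {b}) (map_prod m m ` E) (map_prod m m ` D) G"
      proof (rule constrained_mapsI)
        show "restrict \<phi> (V - {b}) \<in> V - {b} \<rightarrow>\<^sub>E pverts G"
          using constrained_mapsD(1)[OF \<phi>] by (auto simp: PiE_iff)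
      next
        fix i j assume "(i, j) \<in> map_prod m m ` E"
        then obtain i' j' where ij: "(i', j') \<in> E" "i = m i'" "j = m j'"
          by auto
        then show "(restrict \<phi> (V - {b}) i, restrict \<phi> (V - {b}) j) \<in> parcs G"
          using constrained_mapsD(2)[OF \<phi> ij(1)] res[of i'] res[of j'] subsetD[OF E ij(1)] by simp
      next
        fix i j assume "(i, j) \<in> map_prod m m ` D"
        then obtain i' j' where ij: "(i', j') \<in> D" "i = m i'" "j = m j'"
          by auto
        then show "restrict \<phi> (V - {b}) i \<noteq> restrict \<phi> (V - {b}) j"
          using constrained_mapsD(3)[OF \<phi> ij(1)] res[of i'] res[of j'] subsetD[OF D ij(1)] by simp
      qed
    qed
    show "(\<lambda>\<psi>. restrict (\<psi> \<circ> m) V) \<in>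
        constrained_maps (V - {b}) (map_prod m m ` E) (map_prod m m ` D) G \<rightarrow> ?eq"
    proof
      fix \<psi> assume \<psi>: "\<psi> \<in> constrained_maps (V - {b}) (map_prod m m ` E) (map_prod m m ` D) G"
      have res: "restrict (\<psi> \<circ> m) V i = \<psi> (m i)" if "i \<in> V" for i
        using that by simp
      have "restrict (\<psi> \<circ> m) V \<in> constrained_maps V E D G"
      proof (rule constrained_mapsI)
        show "restrict (\<psi> \<circ> m) V \<in> V \<rightarrow>\<^sub>E pverts G"
          using constrained_mapsD(1)[OF \<psi>] m by (auto simp: PiE_iff)
      next
        fix i j assume ij: "(i, j) \<in> E"
        then have "(m i, m j) \<in> map_prod m m ` E"
          by force
        then show "(restrict (\<psi> \<circ> m) V i, restrict (\<psi> \<circ> m) V j) \<in> parcs G"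
          using constrained_mapsD(2)[OF \<psi>] res[of i] res[of j] subsetD[OF E ij] by simp
      next
        fix i j assume ij: "(i, j) \<in> D"
        then have "(m i, m j) \<in> map_prod m m ` D"
          by force
        then show "restrict (\<psi> \<circ> m) V i \<noteq> restrict (\<psi> \<circ> m) V j"
          using constrained_mapsD(3)[OF \<psi>] res[of i] res[of j] subsetD[OF D ij] by simp
      qed
      moreover have "restrict (\<psi> \<circ> m) V a = restrict (\<psi> \<circ> m) V b"
        using ab by (simp add: m_def)
      ultimately show "restrict (\<psi> \<circ> m) V \<in> ?eq"
        by simp
    qed
    show "restrict (restrict \<phi> (V - {b}) \<circ> m) V = \<phi>" if "\<phi> \<in> ?eq" for \<phi>
    proof
      fix i
      show "restrict (restrict \<phi> (V - {b}) \<circ> m) V i = \<phi> i"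
        using that m[of i] by (cases "i \<in> V") (auto simp: constrained_maps_def m_def)
    qed
    show "restrict (restrict (\<psi> \<circ> m) V) (V - {b}) = \<psi>"
      if "\<psi> \<in> constrained_maps (V - {b}) (map_prod m m ` E) (map_prod m m ` D) G" for \<psi>
    proof
      fix i
      show "restrict (restrict (\<psi> \<circ> m) V) (V - {b}) i = \<psi> i"
        using that by (cases "i \<in> V - {b}") (auto simp: constrained_maps_def m_def PiE_iff extensional_def)
    qed
  qed
  ultimately show ?thesis
    by (simp add: bij_betw_same_card)
qed

text \<open>Moebius inversion over the disequalities: merging two vertices keeps the vertex cover small.\<close>

lemma card_constrained_maps_cong:
  fixes V :: "nat set" and G G' :: "'b pair_pre_digraph"
  assumes G: "pair_graph G" "pair_graph G'"
    and hom: "\<And>F :: nat pair_pre_digraph.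
      pair_graph F \<Longrightarrow> treewidth F \<le> d \<Longrightarrow> hom_count F G = hom_count F G'"
    and "finite V" "E \<subseteq> V \<times> V" "D \<subseteq> V \<times> V" "C \<subseteq> V" "card C \<le> d"
    and "\<And>i j. (i, j) \<in> E \<Longrightarrow> i \<in> C \<or> j \<in> C"
  shows "card (constrained_maps V E D G) = card (constrained_maps V E D G')"
  using assms(4-)
\<comment> \<open>Merging changes \<open>V\<close>, \<open>E\<close> and \<open>C\<close> along with
  \<open>D\<close>, so all of them are generalised; the bound \<open>d\<close> stays fixed.\<close>
proof (induction "card D" arbitrary: V E D C rule: less_induct)
  case less
  show ?case
  proof (cases "D = {}")
    case True
    show ?thesis
    \<comment> \<open>Merging the ends of an edge creates a loop; no map sends it to an arc of a
      loopfree graph, so both counts vanish.\<close>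
    proof (cases "irrefl E")
      case False
      then obtain i where "(i, i) \<in> E"
        by (auto simp: irrefl_def)
      then have "constrained_maps V E D G = {}" "constrained_maps V E D G' = {}"
        using pair_graphD(4)[OF G(1)] pair_graphD(4)[OF G(2)]
        by (fastforce simp: constrained_maps_def irrefl_def)+
      then show ?thesis by simp
    next
      case irr: True
      \<comment> \<open>Adding the converse makes \<open>F\<close> undirected and keeps the same
        maps, as the targets are symmetric.\<close>
      define F where "F = \<lparr>pverts = V, parcs = E \<union> E\<inverse>\<rparr>"
      have F: "pair_graph F"
        using less.prems irr by (intro pair_graphI) (auto simp: F_def irrefl_def intro!: symI)
      have "treewidth F \<le> card C"
        using less.prems(4) by (intro treewidth_le_vertex_cover F) (auto simp: F_def dest: less.prems(6))
      then have "hom_count F G = hom_count F G'"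
        using hom[OF F] less.prems by simp
      moreover have "graph_homs F H = constrained_maps V E D H" if "pair_graph H"
        for H :: "'b pair_pre_digraph"
      proof -
        have "(\<forall>(u, v)\<in>E \<union> E\<inverse>. (h u, h v) \<in> parcs H) \<longleftrightarrow> (\<forall>(u, v)\<in>E. (h u, h v) \<in> parcs H)"
          for h
          using symD[OF pair_graphD(3)[OF that]] by blast
        then show ?thesis
          by (simp add: graph_homs_def constrained_maps_def F_def True)
      qed
      ultimately show ?thesis
        using G by (simp add: hom_count_def)
    qed
  next
    case False
    then obtain a b D0 where D0: "D = insert (a, b) D0" "(a, b) \<notin> D0"
      by (metis Set.set_insert ex_in_conv surj_pair)
    have finD: "finite D"
      using less.prems by (meson finite_SigmaI finite_subset)
    then have card: "card D0 < card D"
      using D0 by simp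
    have sub: "D0 \<subseteq> V \<times> V" and ab: "a \<in> V" "b \<in> V"
      using D0 less.prems by auto
    show ?thesis
    \<comment> \<open>Merging also turns a disequality \<open>(b, a)\<close> into the unsatisfiable
      \<open>(a, a)\<close>.\<close>
    proof (cases "a = b")
      case True
      then have "constrained_maps V E D G = {}" "constrained_maps V E D G' = {}"
        by (auto simp: constrained_maps_def D0)
      then show ?thesis by simp
    next
      case ne: False
      define m where "m i = (if i = b then a else i)" for i
      have split: "card (constrained_maps V E D0 H) = card (constrained_maps V E D H) +
          card (constrained_maps (V - {b}) (map_prod m m ` E) (map_prod m m ` D0) H)"
        if "pair_graph H" for H :: "'b pair_pre_digraph"
        using card_constrained_maps_split[OF that less.prems(1) ab ne less.prems(2) sub]
        unfolding D0 m_def .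
      have "card (constrained_maps V E D0 G) = card (constrained_maps V E D0 G')"
        by (rule less.hyps[OF card less.prems(1,2) sub less.prems(4,5,6)])
      moreover have "card (constrained_maps (V - {b}) (map_prod m m ` E) (map_prod m m ` D0) G) =
          card (constrained_maps (V - {b}) (map_prod m m ` E) (map_prod m m ` D0) G')"
      proof (rule less.hyps[of _ _ _ "m ` C"])
        have "card (map_prod m m ` D0) \<le> card D0"
          using finD D0 by (intro card_image_le) simp
        then show "card (map_prod m m ` D0) < card D"
          using card by simp
        have m: "m i \<in> V - {b}" if "i \<in> V" for i
          using that ab ne by (auto simp: m_def)
        show "map_prod m m ` E \<subseteq> (V - {b}) \<times> (V - {b})"
          "map_prod m m ` D0 \<subseteq> (V - {b}) \<times> (V - {b})" "m ` C \<subseteq> V - {b}"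
          using m sub less.prems by (auto dest!: subsetD)
        show "card (m ` C) \<le> d"
          using card_image_le[of C m] finite_subset[OF less.prems(4) less.prems(1)] less.prems by simp
        show "i \<in> m ` C \<or> j \<in> m ` C" if "(i, j) \<in> map_prod m m ` E" for i j
          using that less.prems(6) by auto
      qed (use less.prems in auto)
      ultimately show ?thesis
        using split[OF G(1)] split[OF G(2)] by simp
    qed
  qed
qed

section \<open>Expansion of the even-degree indicator\<close>

text \<open>Each pair off the diagonal occurs in both orders and contributes a square, which is
  \<open>1\<close>.\<close>

lemma prod_symmetric_sign:
  fixes s :: "'a \<Rightarrow> 'a \<Rightarrow> int"
  assumes "finite S" "\<And>i j. s i j = s j i" "\<And>i. s i i = 1" "\<And>i j. s i j * s i j = 1"
  shows "(\<Prod>i\<in>S. \<Prod>j\<in>S. s i j) = 1"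
  using assms(1)
proof (induction S rule: finite_induct)
  case (insert x S)
  have "(\<Prod>i\<in>insert x S. \<Prod>j\<in>insert x S. s i j) =
      (\<Prod>j\<in>S. s x j) * ((\<Prod>i\<in>S. s i x) * (\<Prod>i\<in>S. \<Prod>j\<in>S. s i j))"
    using insert.hyps assms(3) by (simp add: prod.distrib)
  also have "\<dots> = (\<Prod>j\<in>S. s x j * s x j)"
    using insert.IH assms(2)[of _ x] by (simp add: prod.distrib)
  also have "\<dots> = 1"
    by (simp add: assms(4))
  finally show ?case .
qed simp

text \<open>
  The degree sum over \<open>S\<close> counts every edge inside \<open>S\<close> twice, so only the edges between \<open>S\<close>
  and its complement contribute to the sign; each of these has sign \<open>1 - 2 A\<close>.
\<close>

lemma even_degrees_expansion:
  fixes A :: "'a \<Rightarrow> 'a \<Rightarrow> bool"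
  assumes I: "finite I" and sym: "\<And>i j. A i j = A j i" and irr: "\<And>i. \<not> A i i"
  shows "(if \<forall>i\<in>I. even (card {j\<in>I. A i j}) then 2 ^ card I else 0) =
    (\<Sum>S\<in>Pow I. \<Sum>E\<in>Pow (S \<times> (I - S)). (- 2) ^ card E * (of_bool (\<forall>(i, j)\<in>E. A i j) :: int))"
proof -
  define s where "s i j = (if A i j then - 1 else 1 :: int)" for i j
  have deg: "(\<Prod>j\<in>I. s i j) = (- 1) ^ card {j\<in>I. A i j}" for i
    using I by (simp add: s_def prod.If_cases Int_def)
  \<comment> \<open>The factor of a vertex is \<open>2\<close> if its degree is even and
    \<open>0\<close> if it is odd. Expanding the product, \<open>S\<close> is the set of vertices
    that contribute their sign.\<close>
  have "(\<Prod>i\<in>I. (\<Prod>j\<in>I. s i j) + 1) = (if \<forall>i\<in>I. even (card {j\<in>I. A i j}) then 2 ^ card I else 0)"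
  proof (cases "\<forall>i\<in>I. even (card {j\<in>I. A i j})")
    case True
    then show ?thesis by (simp add: deg)
  next
    case False
    then obtain i where "i \<in> I" "odd (card {j\<in>I. A i j})"
      by blast
    then have "\<exists>i\<in>I. (\<Prod>j\<in>I. s i j) + 1 = 0"
      by (intro bexI[of _ i]) (simp_all add: deg)
    then show ?thesis
      using False I by (simp add: prod_zero)
  qed
  also have "(\<Prod>i\<in>I. (\<Prod>j\<in>I. s i j) + 1) = (\<Sum>S\<in>Pow I. \<Prod>i\<in>S. \<Prod>j\<in>I. s i j)"
    by (simp add: prod_add[OF I])
  also have "\<dots> = (\<Sum>S\<in>Pow I. \<Sum>E\<in>Pow (S \<times> (I - S)). (- 2) ^ card E * of_bool (\<forall>(i, j)\<in>E. A i j))"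
  proof (rule sum.cong)
    fix S assume "S \<in> Pow I"
    then have S: "S \<subseteq> I" "finite S"
      using I finite_subset by auto
    have "(\<Prod>i\<in>S. \<Prod>j\<in>I. s i j) = (\<Prod>i\<in>S. (\<Prod>j\<in>S. s i j) * (\<Prod>j\<in>I - S. s i j))"
      using S I by (simp add: prod.subset_diff[OF S(1) I] mult.commute)
    also have "\<dots> = (\<Prod>i\<in>S. \<Prod>j\<in>I - S. s i j)"
      using prod_symmetric_sign[OF S(2), of s] sym irr by (simp add: prod.distrib s_def)
    also have "\<dots> = (\<Prod>e\<in>S \<times> (I - S). - 2 * of_bool (case e of (i, j) \<Rightarrow> A i j) + 1)"
      by (simp add: prod.cartesian_product s_def) (rule prod.cong, auto)
    \<comment> \<open>A second expansion: \<open>E\<close> collects the pairs that contribute the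
      summand other than \<open>1\<close>. Hence every \<open>E\<close> is bipartite between
      \<open>S\<close> and its complement.\<close>
    also have "\<dots> = (\<Sum>E\<in>Pow (S \<times> (I - S)). \<Prod>e\<in>E. - 2 * of_bool (case e of (i, j) \<Rightarrow> A i j))"
      using S I by (subst prod_add) auto
    also have "\<dots> = (\<Sum>E\<in>Pow (S \<times> (I - S)). (- 2) ^ card E * of_bool (\<forall>(i, j)\<in>E. A i j))"
    proof (rule sum.cong)
      fix E assume "E \<in> Pow (S \<times> (I - S))"
      then have "finite E"
        using S I by (meson PowD finite_Diff finite_SigmaI finite_subset)
      then show "(\<Prod>e\<in>E. - 2 * of_bool (case e of (i, j) \<Rightarrow> A i j)) =
          (- 2) ^ card E * (of_bool (\<forall>(i, j)\<in>E. A i j) :: int)"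
        by (cases "\<forall>(i, j)\<in>E. A i j") (auto simp: prod.distrib intro!: prod_zero)
    qed simp
    finally show "(\<Prod>i\<in>S. \<Prod>j\<in>I. s i j) =
        (\<Sum>E\<in>Pow (S \<times> (I - S)). (- 2) ^ card E * of_bool (\<forall>(i, j)\<in>E. A i j))" .
  qed simp
  finally show ?thesis by simp
qed

text \<open>Each vertex set of size \<open>k\<close> is the image of exactly \<open>fact k\<close>
  injections. These have a fixed domain, over which the indicator can be expanded.\<close>

lemma num_indsub_even_injections:
  assumes G: "pair_graph G"
  shows "fact k * num_indsub (Phi_even k) G =
    card {\<phi> \<in> {..<k} \<rightarrow>\<^sub>E pverts G. inj_on \<phi> {..<k} \<and>
      (\<forall>i<k. even (card {j\<in>{..<k}. (\<phi> i, \<phi> j) \<in> parcs G}))}"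
    (is "_ = card ?\<Phi>")
proof -
  let ?ev = "\<lambda>X. \<forall>v\<in>X. even (card {w\<in>X. (v, w) \<in> parcs G})"
  let ?\<X> = "{X. X \<subseteq> pverts G \<and> card X = k \<and> ?ev X}"
  let ?I = "\<lambda>X. {\<phi> \<in> {..<k} \<rightarrow>\<^sub>E X. inj_on \<phi> {..<k}}"
  have fin: "finite X" if "X \<in> ?\<X>" for X
    using that pair_graphD(1)[OF G] finite_subset by auto
  have fin': "finite ?\<X>"
    using pair_graphD(1)[OF G] by simp
  \<comment> \<open>An injection into a set of the same size is onto, so it determines
    \<open>X\<close>.\<close>
  have surj: "\<phi> ` {..<k} = X" if "\<phi> \<in> ?I X" "X \<in> ?\<X>" for \<phi> X
    using that fin[OF that(2)] by (intro card_subset_eq) (auto simp: card_image PiE_iff)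
  have cnt: "card {w \<in> \<phi> ` {..<k}. (\<phi> i, w) \<in> parcs G} = card {j\<in>{..<k}. (\<phi> i, \<phi> j) \<in> parcs G}"
    if "inj_on \<phi> {..<k}" for \<phi> i
  proof -
    have "{w \<in> \<phi> ` {..<k}. (\<phi> i, w) \<in> parcs G} = \<phi> ` {j\<in>{..<k}. (\<phi> i, \<phi> j) \<in> parcs G}"
      by auto
    then show ?thesis
      using that by (metis (no_types, lifting) card_image inj_on_subset mem_Collect_eq subsetI)
  qed
  have ev: "?ev (\<phi> ` {..<k}) \<longleftrightarrow> (\<forall>i<k. even (card {j\<in>{..<k}. (\<phi> i, \<phi> j) \<in> parcs G}))"
    if "inj_on \<phi> {..<k}" for \<phi>
    using cnt[OF that] by auto
  have "?\<Phi> = (\<Union>X\<in>?\<X>. ?I X)"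
  proof (intro equalityI subsetI)
    fix \<phi> assume "\<phi> \<in> ?\<Phi>"
    then have "\<phi> ` {..<k} \<in> ?\<X>" "\<phi> \<in> ?I (\<phi> ` {..<k})"
      using ev[of \<phi>] by (auto simp: card_image PiE_iff)
    then show "\<phi> \<in> (\<Union>X\<in>?\<X>. ?I X)"
      by blast
  next
    fix \<phi> assume "\<phi> \<in> (\<Union>X\<in>?\<X>. ?I X)"
    then obtain X where X: "X \<in> ?\<X>" "\<phi> \<in> ?I X"
      by blast
    then have "?ev (\<phi> ` {..<k})"
      using surj[OF X(2,1)] by simp
    then show "\<phi> \<in> ?\<Phi>"
      using X ev[of \<phi>] by (auto simp: PiE_iff)
  qed
  moreover have "card (\<Union>X\<in>?\<X>. ?I X) = (\<Sum>X\<in>?\<X>. card (?I X))"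
  proof (rule card_UN_disjoint[OF fin'])
    have "finite ({..<k} \<rightarrow>\<^sub>E X)" if "X \<in> ?\<X>" for X
      using fin[OF that] by (intro finite_PiE) auto
    then show "\<forall>X\<in>?\<X>. finite (?I X)"
      by simp
    show "\<forall>X\<in>?\<X>. \<forall>Y\<in>?\<X>. X \<noteq> Y \<longrightarrow> ?I X \<inter> ?I Y = {}"
    proof (intro ballI impI)
      fix X Y assume XY: "X \<in> ?\<X>" "Y \<in> ?\<X>" "X \<noteq> Y"
      have "X = Y" if "\<phi> \<in> ?I X" "\<phi> \<in> ?I Y" for \<phi>
        using surj[OF that(1) XY(1)] surj[OF that(2) XY(2)] by simp
      then show "?I X \<inter> ?I Y = {}"
        using XY(3) by blast
    qed
  qed
  moreover have "card (?I X) = fact k" if "X \<in> ?\<X>" for X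
    using card_inj_on_subset_funcset[of "{..<k}" X "{..<k}"] fin[OF that] that
    by (simp add: fact_prod_rev)
  ultimately show ?thesis
    by (simp add: num_indsub_even_conv[OF G])
qed

text \<open>The indicator is expanded for each injection and the sums are exchanged. The factor
  \<open>2 ^ k\<close> clears the average over \<open>S\<close>, and \<open>fact k\<close> accounts
  for the labellings.\<close>

lemma num_indsub_even_expansion:
  assumes G: "pair_graph G"
  shows "2 ^ k * fact k * int (num_indsub (Phi_even k) G) =
    (\<Sum>S\<in>Pow {..<k}. \<Sum>E\<in>Pow (S \<times> ({..<k} - S)). (- 2) ^ card E *
      int (card (constrained_maps {..<k} E {(i, j). i < k \<and> j < k \<and> i \<noteq> j} G)))"
proof -
  let ?inj = "{\<phi> \<in> {..<k} \<rightarrow>\<^sub>E pverts G. inj_on \<phi> {..<k}}"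
  let ?A = "\<lambda>\<phi> i j. (\<phi> i, \<phi> j) \<in> parcs G"
  let ?ev = "\<lambda>\<phi>. \<forall>i\<in>{..<k}. even (card {j\<in>{..<k}. ?A \<phi> i j})"
  have fin: "finite ?inj"
    using pair_graphD(1)[OF G] by (auto intro!: finite_PiE)
  have "fact k * num_indsub (Phi_even k) G = card {\<phi> \<in> ?inj. ?ev \<phi>}"
    unfolding num_indsub_even_injections[OF G] by (rule arg_cong[of _ _ card]) auto
  then have "2 ^ k * fact k * int (num_indsub (Phi_even k) G) = 2 ^ k * int (card {\<phi> \<in> ?inj. ?ev \<phi>})"
    by (metis mult.assoc of_nat_fact of_nat_mult)
  also have "\<dots> = (\<Sum>\<phi>\<in>?inj. if ?ev \<phi> then 2 ^ k else 0)"
    using fin by (simp add: sum.If_cases Int_def conj_commute)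
  also have "\<dots> = (\<Sum>\<phi>\<in>?inj. \<Sum>S\<in>Pow {..<k}. \<Sum>E\<in>Pow (S \<times> ({..<k} - S)).
      (- 2) ^ card E * of_bool (\<forall>(i, j)\<in>E. ?A \<phi> i j))"
  proof (rule sum.cong)
    fix \<phi>
    show "(if ?ev \<phi> then 2 ^ k else 0) = (\<Sum>S\<in>Pow {..<k}. \<Sum>E\<in>Pow (S \<times> ({..<k} - S)).
        (- 2) ^ card E * (of_bool (\<forall>(i, j)\<in>E. ?A \<phi> i j) :: int))"
      using even_degrees_expansion[of "{..<k}" "?A \<phi>", unfolded card_lessThan]
        pair_graphD(4)[OF G] symD[OF pair_graphD(3)[OF G]]
      unfolding irrefl_def by blast
  qed simp
  also have "\<dots> = (\<Sum>S\<in>Pow {..<k}. \<Sum>E\<in>Pow (S \<times> ({..<k} - S)).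
      (- 2) ^ card E * (\<Sum>\<phi>\<in>?inj. of_bool (\<forall>(i, j)\<in>E. ?A \<phi> i j)))"
    by (simp add: sum.swap[of _ ?inj] sum_distrib_left)
  also have "\<dots> = (\<Sum>S\<in>Pow {..<k}. \<Sum>E\<in>Pow (S \<times> ({..<k} - S)). (- 2) ^ card E *
      int (card (constrained_maps {..<k} E {(i, j). i < k \<and> j < k \<and> i \<noteq> j} G)))"
  proof (intro sum.cong arg_cong2[of _ _ _ _ "(*)"] refl)
    fix E :: "(nat \<times> nat) set"
    have "{\<phi> \<in> ?inj. \<forall>(i, j)\<in>E. ?A \<phi> i j} =
        constrained_maps {..<k} E {(i, j). i < k \<and> j < k \<and> i \<noteq> j} G"
      by (auto simp: constrained_maps_def inj_on_def)
    moreover have "(\<Sum>\<phi>\<in>?inj. of_bool (\<forall>(i, j)\<in>E. ?A \<phi> i j)) =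
        int (card {\<phi> \<in> ?inj. \<forall>(i, j)\<in>E. ?A \<phi> i j})"
      using fin by (simp add: of_bool_def sum.If_cases Int_def)
    ultimately show "(\<Sum>\<phi>\<in>?inj. of_bool (\<forall>(i, j)\<in>E. ?A \<phi> i j)) =
        int (card (constrained_maps {..<k} E {(i, j). i < k \<and> j < k \<and> i \<noteq> j} G))"
      by simp
  qed
  finally show ?thesis .
qed

text \<open>The smaller of \<open>S\<close> and \<open>{..<k} - S\<close> has at most
  \<open>k div 2\<close> elements and covers all edges of \<open>E\<close>, so each term of the
  expansion is determined by the given homomorphism counts.\<close>

lemma num_indsub_even_determined:
  fixes G G' :: "'b pair_pre_digraph"
  assumes G: "pair_graph G" "pair_graph G'"
    and hom: "\<And>F :: nat pair_pre_digraph.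
      pair_graph F \<Longrightarrow> treewidth F \<le> k div 2 \<Longrightarrow> hom_count F G = hom_count F G'"
  shows "num_indsub (Phi_even k) G = num_indsub (Phi_even k) G'"
proof -
  let ?D = "{(i, j). i < k \<and> j < k \<and> i \<noteq> j}"
  have "card (constrained_maps {..<k} E ?D G) = card (constrained_maps {..<k} E ?D G')"
    if "S \<subseteq> {..<k}" "E \<subseteq> S \<times> ({..<k} - S)" for S E
  proof -
    have "card S + card ({..<k} - S) = k"
      using that(1) by (simp add: card_Diff_subset finite_subset card_mono[of "{..<k}", simplified])
    then have "card S \<le> k div 2 \<or> card ({..<k} - S) \<le> k div 2"
      by linarith
    then obtain C where "C = S \<or> C = {..<k} - S" "card C \<le> k div 2"
      by blast
    then show ?thesis
      using that by (intro card_constrained_maps_cong[OF G hom, where C = C]) auto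
  qed
  then have "2 ^ k * fact k * int (num_indsub (Phi_even k) G) =
      2 ^ k * fact k * int (num_indsub (Phi_even k) G')"
    unfolding num_indsub_even_expansion[OF G(1)] num_indsub_even_expansion[OF G(2)]
    by (intro sum.cong refl) auto
  then show ?thesis
    by simp
qed

section \<open>Lower bound\<close>

text \<open>The Weisfeiler-Leman dimension is stated for graphs on \<open>nat\<close>, so a pair of
  a base vertex and a finite set is coded as a number. Every number is such a code.\<close>

definition colour :: "nat \<Rightarrow> nat" where
  "colour n = fst (prod_decode n)"

definition label :: "nat \<Rightarrow> nat set" where
  "label n = set_decode (snd (prod_decode n))"

definition vert :: "nat \<Rightarrow> nat set \<Rightarrow> nat" where
  "vert v X = prod_encode (v, set_encode X)"

lemma colour_vert [simp]: "colour (vert v X) = v"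
  by (simp add: colour_def vert_def)

lemma label_vert: "finite X \<Longrightarrow> label (vert v X) = X"
  by (simp add: label_def vert_def set_encode_inverse)

lemma vert_colour_label: "vert (colour n) (label n) = n"
  by (simp add: colour_def label_def vert_def set_decode_inverse)

lemma finite_label [simp]: "finite (label n)"
  by (simp add: label_def)

text \<open>For \<open>v < k\<close>, the neighbourhood in the complete bipartite base graph with
  sides \<open>{..<c}\<close> and \<open>{c..<k}\<close>.\<close>

definition nbrs :: "nat \<Rightarrow> nat \<Rightarrow> nat \<Rightarrow> nat set" where
  "nbrs c k v = {w. w < k \<and> (w < c \<longleftrightarrow> \<not> v < c)}"

lemma finite_nbrs [simp]: "finite (nbrs c k v)"
  by (simp add: nbrs_def)

text \<open>
  The graph of Cai, Fuerer and Immerman over the part induced by \<open>W\<close> of the complete bipartite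
  graph with sides \<open>{..<c}\<close> and \<open>{c..<k}\<close>; a label is a set of base edges at the colour, given by
  their other ends, and \<open>b\<close> tells whether the vertex 0 is twisted. The labels of adjacent vertices differ at
  their common base edge, so that the empty labels span no edge.
\<close>

definition cfi_verts :: "nat \<Rightarrow> nat \<Rightarrow> bool \<Rightarrow> nat set \<Rightarrow> nat set" where
  "cfi_verts c k b W =
    {n. colour n \<in> W \<and> label n \<subseteq> nbrs c k (colour n) \<and> (odd (card (label n)) \<longleftrightarrow> b \<and> colour n = 0)}"

definition cfi :: "nat \<Rightarrow> nat \<Rightarrow> bool \<Rightarrow> nat set \<Rightarrow> nat pair_pre_digraph" where
  "cfi c k b W =
    \<lparr>pverts = cfi_verts c k b W,
     parcs = {(m, n). m \<in> cfi_verts c k b W \<and> n \<in> cfi_verts c k b W \<and>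
       colour n \<in> nbrs c k (colour m) \<and> (colour n \<in> label m \<longleftrightarrow> colour m \<notin> label n)}\<rparr>"

lemma pair_graph_cfi:
  assumes "W \<subseteq> {..<k}"
  shows "pair_graph (cfi c k b W)"
proof (rule pair_graphI)
  have "cfi_verts c k b W \<subseteq> (\<lambda>(v, X). vert v X) ` ({..<k} \<times> Pow {..<k})"
  proof
    fix n assume "n \<in> cfi_verts c k b W"
    then have "(colour n, label n) \<in> {..<k} \<times> Pow {..<k}"
      using assms by (auto simp: cfi_verts_def nbrs_def)
    then show "n \<in> (\<lambda>(v, X). vert v X) ` ({..<k} \<times> Pow {..<k})"
      by (rule rev_image_eqI) (simp add: vert_colour_label)
  qed
  then show "finite (pverts (cfi c k b W))"
    by (auto simp: cfi_def intro: finite_subset)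
  show "parcs (cfi c k b W) \<subseteq> pverts (cfi c k b W) \<times> pverts (cfi c k b W)"
    by (auto simp: cfi_def)
  show "sym (parcs (cfi c k b W))"
    using assms by (auto simp: cfi_def cfi_verts_def nbrs_def intro!: symI)
  show "irrefl (parcs (cfi c k b W))"
    by (auto simp: cfi_def nbrs_def irrefl_def)
qed

section \<open>Transversals and the difference in the invariant\<close>

lemma odd_card_sym_diff:
  assumes "finite A" "finite B"
  shows "odd (card (sym_diff A B)) \<longleftrightarrow> odd (card A) \<noteq> odd (card B)"
proof -
  have "card (sym_diff A B) = card (A - B) + card (B - A)"
    using assms by (intro card_Un_disjoint) auto
  moreover have "card A = card (A - B) + card (A \<inter> B)" "card B = card (B - A) + card (A \<inter> B)"
    using card_Int_Diff[OF assms(1), of B] card_Int_Diff[OF assms(2), of A] by (simp_all add: Int_commute)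
  ultimately show ?thesis
    by presburger
qed

text \<open>
  The number of edges of a transversal between the two sides is congruent to the total size of
  its labels, hence odd if the vertex 0 is twisted.
\<close>

lemma no_even_transversal:
  assumes c: "1 \<le> c" "c \<le> k"
    and X: "X \<subseteq> pverts (cfi c k True {..<k})" "card X = k" "colour ` X = {..<k}"
    and even: "\<forall>x\<in>X. even (card {y\<in>X. (x, y) \<in> parcs (cfi c k True {..<k})})"
  shows False
proof -
  have finX: "finite X"
    using X c by (metis card.infinite not_one_le_zero le_zero_eq)
  have inj: "inj_on colour X"
    using X finX by (intro eq_card_imp_inj_on) auto
  \<comment> \<open>\<open>x v\<close> is the only vertex of colour \<open>v\<close> in
    \<open>X\<close>.\<close>
  define x where "x = inv_into X colour"
  have x: "x v \<in> X" "colour (x v) = v" if "v < k" for v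
    using that X(3) by (auto simp: x_def intro!: inv_into_into f_inv_into_f)
  have X_eq: "X = x ` {..<k}"
    using inv_into_image_cancel[OF inj subset_refl] X(3) by (simp add: x_def)
  have x_inj: "inj_on x {..<k}"
    unfolding x_def using X(3) by (intro inj_on_inv_into) simp
  define L where "L v = label (x v)" for v
  have L: "L v \<subseteq> nbrs c k v" "odd (card (L v)) \<longleftrightarrow> v = 0" if "v < k" for v
    using x[OF that] subsetD[OF X(1) x(1)[OF that]] by (auto simp: L_def cfi_def cfi_verts_def)
  have adj: "(x v, x w) \<in> parcs (cfi c k True {..<k}) \<longleftrightarrow>
      w \<in> nbrs c k v \<and> (w \<in> L v \<longleftrightarrow> v \<notin> L w)" if "v < k" "w < k" for v w
    using x[OF that(1)] x[OF that(2)] subsetD[OF X(1) x(1)[OF that(1)]] subsetD[OF X(1) x(1)[OF that(2)]]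
    by (simp add: L_def cfi_def)
  \<comment> \<open>Each edge has exactly one end with colour below \<open>c\<close>, so the degrees
    on this side already add up to the number of edges.\<close>
  have deg: "even (card {w\<in>{c..<k}. w \<in> L v \<longleftrightarrow> v \<notin> L w})" if "v < c" for v
  proof -
    have v: "v < k"
      using that c by simp
    have "{y\<in>X. (x v, y) \<in> parcs (cfi c k True {..<k})} =
        x ` {w\<in>{c..<k}. w \<in> L v \<longleftrightarrow> v \<notin> L w}"
      unfolding X_eq using adj[OF v] that by (auto simp: nbrs_def)
    moreover have "card (x ` {w\<in>{c..<k}. w \<in> L v \<longleftrightarrow> v \<notin> L w}) = card {w\<in>{c..<k}. w \<in> L v \<longleftrightarrow> v \<notin> L w}"
      by (rule card_image, rule inj_on_subset[OF x_inj]) auto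
    ultimately show ?thesis
      using even x(1)[OF v] by metis
  qed
  \<comment> \<open>Adjacency is an exclusive or, hence modulo 2 the sum of the two memberships; the
    doubled term makes this an equation in \<open>nat\<close>.\<close>
  have split: "card {w\<in>{c..<k}. w \<in> L v \<longleftrightarrow> v \<notin> L w} + 2 * card {w\<in>{c..<k}. w \<in> L v \<and> v \<in> L w} =
      card {w\<in>{c..<k}. w \<in> L v} + card {w\<in>{c..<k}. v \<in> L w}" for v
  proof -
    have "of_bool (P \<longleftrightarrow> \<not> Q) + 2 * of_bool (P \<and> Q) = of_bool P + (of_bool Q :: nat)" for P Q
      by simp
    then have "(\<Sum>w\<in>{c..<k}. of_bool (w \<in> L v \<longleftrightarrow> v \<notin> L w) + 2 * of_bool (w \<in> L v \<and> v \<in> L w)) =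
        (\<Sum>w\<in>{c..<k}. of_bool (w \<in> L v) + (of_bool (v \<in> L w) :: nat))"
      by presburger
    then show ?thesis
      by (simp add: sum.distrib sum_distrib_left[symmetric] sum_of_bool_eq Int_def conj_commute)
  qed
  have "even (\<Sum>v<c. card {w\<in>{c..<k}. w \<in> L v \<longleftrightarrow> v \<notin> L w} + 2 * card {w\<in>{c..<k}. w \<in> L v \<and> v \<in> L w})"
    using deg by (intro dvd_sum) simp
  then have "even ((\<Sum>v<c. card {w\<in>{c..<k}. w \<in> L v}) + (\<Sum>v<c. card {w\<in>{c..<k}. v \<in> L w}))"
    unfolding split sum.distrib .
  moreover have "(\<Sum>v<c. card {w\<in>{c..<k}. w \<in> L v}) = (\<Sum>v<c. card (L v))"
  proof (rule sum.cong)
    fix v assume "v \<in> {..<c}"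
    then have "{w\<in>{c..<k}. w \<in> L v} = L v"
      using L(1)[of v] c by (auto simp: nbrs_def)
    then show "card {w\<in>{c..<k}. w \<in> L v} = card (L v)"
      by simp
  qed simp
  moreover have "(\<Sum>v<c. card {w\<in>{c..<k}. v \<in> L w}) = (\<Sum>w\<in>{c..<k}. card (L w))"
  proof -
    have "(\<Sum>v<c. card {w\<in>{c..<k}. v \<in> L w}) = (\<Sum>v<c. \<Sum>w\<in>{c..<k}. of_bool (v \<in> L w))"
      by (simp add: sum_of_bool_eq Int_def)
    also have "\<dots> = (\<Sum>w\<in>{c..<k}. \<Sum>v<c. of_bool (v \<in> L w))"
      by (rule sum.swap)
    also have "\<dots> = (\<Sum>w\<in>{c..<k}. card (L w))"
    proof (rule sum.cong)
      fix w assume w: "w \<in> {c..<k}"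
      then have "{v\<in>{..<c}. v \<in> L w} = L w"
        using L(1)[of w] by (auto simp: nbrs_def)
      moreover have "(\<Sum>v<c. of_bool (v \<in> L w)) = card {v\<in>{..<c}. v \<in> L w}"
        by (simp add: sum_of_bool_eq Int_def)
      ultimately show "(\<Sum>v<c. of_bool (v \<in> L w)) = card (L w)"
        by simp
    qed simp
    finally show ?thesis .
  qed
  moreover have "(\<Sum>v<c. card (L v)) + (\<Sum>w\<in>{c..<k}. card (L w)) = (\<Sum>v<k. card (L v))"
    using c by (simp add: lessThan_atLeast0 sum.atLeastLessThan_concat)
  ultimately have "even (\<Sum>v<k. card (L v))"
    by metis
  \<comment> \<open>Only the twisted vertex has an odd label, so the sum of all label sizes is
    odd.\<close>
  moreover have "{v\<in>{..<k}. odd (card (L v))} = {0}"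
    using L(2) c by auto
  ultimately show False
    by (simp add: even_sum_iff)
qed

text \<open>Empty labels have the parity that the untwisted graph requires, and with no edge among
  them all degrees are zero.\<close>

lemma even_transversal_untwisted:
  fixes c k :: nat
  defines "X \<equiv> (\<lambda>v. vert v {}) ` {..<k}"
  shows "X \<subseteq> pverts (cfi c k False {..<k})" "card X = k" "colour ` X = {..<k}"
    and "\<forall>x\<in>X. even (card {y\<in>X. (x, y) \<in> parcs (cfi c k False {..<k})})"
proof -
  show "X \<subseteq> pverts (cfi c k False {..<k})"
    by (auto simp: X_def cfi_def cfi_verts_def label_vert)
  have "inj_on (\<lambda>v. vert v {}) {..<k}"
    by (metis colour_vert inj_onI)
  then show "card X = k"
    by (simp add: X_def card_image)
  show "colour ` X = {..<k}"
    by (simp add: X_def image_image)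
  have "{y\<in>X. (x, y) \<in> parcs (cfi c k False {..<k})} = {}" if "x \<in> X" for x
    using that by (auto simp: X_def cfi_def label_vert)
  then show "\<forall>x\<in>X. even (card {y\<in>X. (x, y) \<in> parcs (cfi c k False {..<k})})"
    by (metis card.empty even_zero)
qed

text \<open>By induction the terms of all proper subsets agree, which leaves the term of
  \<open>W\<close> itself.\<close>

lemma sum_Pow_cancel:
  fixes f g :: "'a set \<Rightarrow> nat"
  assumes "finite W" "\<And>U. U \<subseteq> W \<Longrightarrow> sum f (Pow U) = sum g (Pow U)"
  shows "f W = g W"
  using assms
proof (induction W rule: finite_psubset_induct)
  case (psubset W)
  have "sum f (Pow W - {W}) = sum g (Pow W - {W})"
  proof (rule sum.cong)
    fix U assume "U \<in> Pow W - {W}"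
    then show "f U = g U"
      using psubset.prems by (intro psubset.IH) auto
  qed simp
  moreover have "sum h (Pow W) = h W + sum h (Pow W - {W})" for h :: "'a set \<Rightarrow> nat"
    using psubset.hyps by (intro sum.remove) auto
  ultimately show ?case
    using psubset.prems[of W] by simp
qed

text \<open>By inclusion-exclusion over the colours, a difference in transversals shows up for some \<open>W\<close>.\<close>

lemma num_indsub_cfi_differ:
  assumes c: "1 \<le> c" "c \<le> k"
  obtains W where "W \<subseteq> {..<k}"
    "num_indsub (Phi_even k) (cfi c k False W) \<noteq> num_indsub (Phi_even k) (cfi c k True W)"
proof -
  define \<X> where "\<X> b = {X. X \<subseteq> pverts (cfi c k b {..<k}) \<and> card X = k \<and>
      (\<forall>x\<in>X. even (card {y\<in>X. (x, y) \<in> parcs (cfi c k b {..<k})}))}" for b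
  \<comment> \<open>\<open>N b U\<close> sorts the even sets of size \<open>k\<close> by their exact
    set of colours; for \<open>U = {..<k}\<close> it counts transversals.\<close>
  define N where "N b U = card {X \<in> \<X> b. colour ` X = U}" for b U
  have fin: "finite (\<X> b)" for b
    using pair_graphD(1)[OF pair_graph_cfi[OF subset_refl]] by (simp add: \<X>_def)
  \<comment> \<open>Restricting the colours to \<open>W\<close> gives an induced subgraph, because
    labels still range over all base edges. Its even sets are those of the full graph with colours
    in \<open>W\<close>.\<close>
  have num: "num_indsub (Phi_even k) (cfi c k b W) = sum (N b) (Pow W)" if W: "W \<subseteq> {..<k}" for b W
  proof -
    have "{X. X \<subseteq> pverts (cfi c k b W) \<and> card X = k \<and>
        (\<forall>x\<in>X. even (card {y\<in>X. (x, y) \<in> parcs (cfi c k b W)}))} = {X \<in> \<X> b. colour ` X \<subseteq> W}"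
    proof (intro Collect_cong)
      fix X
      have sub: "X \<subseteq> pverts (cfi c k b W) \<longleftrightarrow> X \<subseteq> pverts (cfi c k b {..<k}) \<and> colour ` X \<subseteq> W"
        using W by (auto simp: cfi_def cfi_verts_def)
      have "{y\<in>X. (x, y) \<in> parcs (cfi c k b W)} = {y\<in>X. (x, y) \<in> parcs (cfi c k b {..<k})}"
        if "X \<subseteq> pverts (cfi c k b W)" "x \<in> X" for x
        using that W by (auto simp: cfi_def cfi_verts_def)
      then show "(X \<subseteq> pverts (cfi c k b W) \<and> card X = k \<and>
          (\<forall>x\<in>X. even (card {y\<in>X. (x, y) \<in> parcs (cfi c k b W)}))) \<longleftrightarrow>
          X \<in> \<X> b \<and> colour ` X \<subseteq> W"
        unfolding \<X>_def using sub by auto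
    qed
    moreover have "{X \<in> \<X> b. colour ` X \<subseteq> W} = (\<Union>U\<in>Pow W. {X \<in> \<X> b. colour ` X = U})"
      by auto
    moreover have "card (\<Union>U\<in>Pow W. {X \<in> \<X> b. colour ` X = U}) = sum (N b) (Pow W)"
      unfolding N_def using W fin by (intro card_UN_disjoint) (auto intro: finite_subset)
    ultimately show ?thesis
      using num_indsub_even_conv[OF pair_graph_cfi[OF W]] by simp
  qed
  have "{X \<in> \<X> True. colour ` X = {..<k}} = {}"
    using no_even_transversal[OF c] unfolding \<X>_def by blast
  then have "N True {..<k} = 0"
    by (simp only: N_def card.empty)
  moreover have "N False {..<k} \<noteq> 0"
  proof -
    have "(\<lambda>v. vert v {}) ` {..<k} \<in> {X \<in> \<X> False. colour ` X = {..<k}}"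
      using even_transversal_untwisted[where k = k] unfolding \<X>_def by blast
    moreover have "finite {X \<in> \<X> False. colour ` X = {..<k}}"
      using fin by simp
    ultimately show ?thesis
      unfolding N_def by (metis (lifting) card_0_eq empty_iff)
  qed
  ultimately have "N False {..<k} \<noteq> N True {..<k}"
    by simp
  then obtain W where "W \<subseteq> {..<k}" "sum (N False) (Pow W) \<noteq> sum (N True) (Pow W)"
    using sum_Pow_cancel[of "{..<k}" "N False" "N True"] by blast
  then show thesis
    using that num by simp
qed

section \<open>Moving the twist along a tree decomposition\<close>

text \<open>
  \<open>Q v\<close> is the set of neighbours of \<open>v\<close> in a subgraph of the complete bipartite graph whose
  only odd-degree vertices are 0 and \<open>r\<close> (none if \<open>r = 0\<close>).
\<close>

definition join_graph :: "nat \<Rightarrow> nat \<Rightarrow> nat \<Rightarrow> (nat \<Rightarrow> nat set) \<Rightarrow> bool" where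
  "join_graph c k r Q \<longleftrightarrow> (\<forall>v<k. Q v \<subseteq> nbrs c k v \<and>
    (odd (card (Q v)) \<longleftrightarrow> (v = 0) \<noteq> (v = r)) \<and> (\<forall>w<k. w \<in> Q v \<longleftrightarrow> v \<in> Q w))"

text \<open>Toggling the edge between \<open>r\<close> and \<open>r'\<close> flips the parity at
  exactly these two vertices.\<close>

lemma join_graph_move_edge:
  assumes Q: "join_graph c k r Q" and r: "r < k" and r': "r' \<in> nbrs c k r"
  obtains Q' where "join_graph c k r' Q'" "\<And>v. v \<noteq> r \<Longrightarrow> v \<noteq> r' \<Longrightarrow> Q' v = Q v"
proof
  have r'k: "r' < k" and ne: "r \<noteq> r'" and rn: "r \<in> nbrs c k r'"
    using r r' by (auto simp: nbrs_def)
  define Q' where "Q' v = (if v = r then sym_diff (Q r) {r'}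
      else if v = r' then sym_diff (Q r') {r} else Q v)" for v
  have sub: "Q v \<subseteq> nbrs c k v" and par: "odd (card (Q v)) \<longleftrightarrow> (v = 0) \<noteq> (v = r)"
    and sym: "w < k \<Longrightarrow> w \<in> Q v \<longleftrightarrow> v \<in> Q w" if "v < k" for v w
    using Q that by (auto simp: join_graph_def)
  have fin: "finite (Q v)" if "v < k" for v
    using sub[OF that] finite_nbrs finite_subset by blast
  have "Q' v \<subseteq> nbrs c k v" if "v < k" for v
    using sub[OF that] r' rn by (auto simp: Q'_def)
  moreover have "odd (card (Q' v)) \<longleftrightarrow> (v = 0) \<noteq> (v = r')" if v: "v < k" for v
  proof -
    have "odd (card (sym_diff (Q v) {w})) \<longleftrightarrow> \<not> odd (card (Q v))" for w
      using odd_card_sym_diff[OF fin[OF v], of "{w}"] by simp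
    then show ?thesis
      using par[OF v] ne by (auto simp: Q'_def)
  qed
  moreover have "w \<in> Q' v \<longleftrightarrow> v \<in> Q' w" if "v < k" "w < k" for v w
    using sym[OF that] ne by (auto simp: Q'_def)
  ultimately show "join_graph c k r' Q'"
    by (auto simp: join_graph_def)
  show "Q' v = Q v" if "v \<noteq> r" "v \<noteq> r'" for v
    using that by (simp add: Q'_def)
qed

text \<open>Vertices on opposite sides are adjacent, and those on the same side have all neighbours
  in common, so two toggles suffice. \<open>path\<close> provides an intermediate vertex outside
  \<open>Y\<close>, where nothing may change.\<close>

lemma join_graph_move:
  assumes Q: "join_graph c k r Q" and r: "r < k" "r \<notin> Y" and r': "r' < k" "r' \<notin> Y"
    and path: "nbrs c k r \<subseteq> Y \<Longrightarrow> r' = r"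
  shows "\<exists>Q'. join_graph c k r' Q' \<and> (\<forall>v\<in>Y. Q v = Q' v)"
proof -
  consider "r' = r" | "r' \<in> nbrs c k r" | m where "m \<in> nbrs c k r" "r' \<in> nbrs c k m" "m \<notin> Y"
    using r r' path by (auto simp: nbrs_def)
  then show ?thesis
  proof cases
    case 1
    then show ?thesis using Q by blast
  next
    case 2
    then obtain Q' where "join_graph c k r' Q'" "\<And>v. v \<noteq> r \<Longrightarrow> v \<noteq> r' \<Longrightarrow> Q' v = Q v"
      using join_graph_move_edge[OF Q r(1)] by blast
    then show ?thesis
      using r r' by metis
  next
    case 3
    then have m: "m < k"
      by (simp add: nbrs_def)
    obtain Q1 where Q1: "join_graph c k m Q1" "\<And>v. v \<noteq> r \<Longrightarrow> v \<noteq> m \<Longrightarrow> Q1 v = Q v"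
      using join_graph_move_edge[OF Q r(1) 3(1)] by blast
    obtain Q2 where "join_graph c k r' Q2" "\<And>v. v \<noteq> m \<Longrightarrow> v \<noteq> r' \<Longrightarrow> Q2 v = Q1 v"
      using join_graph_move_edge[OF Q1(1) m 3(2)] by blast
    then show ?thesis
      using Q1(2) r r' 3(3) by metis
  qed
qed

text \<open>Meant for the tree nodes whose bags contain a given vertex: local agreement makes a
  value independent of the bag.\<close>

lemma connected_induced_invariant:
  assumes "connected (with_proj T \<restriction> I)"
    and "\<And>t t'. (t, t') \<in> parcs T \<Longrightarrow> t \<in> I \<Longrightarrow> t' \<in> I \<Longrightarrow> f t = f t'"
    and "t \<in> I" "t' \<in> I"
  shows "f t = f t'"
proof -
  have "(t, t') \<in> rtrancl_on I ((parcs T \<inter> I \<times> I)\<^sup>s)"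
    using assms(1,3,4) unfolding connected_induced_conv by blast
  then show ?thesis
  proof (induction rule: rtrancl_on_induct)
    case (step y z)
    then have "f y = f z"
      using assms(2) by (auto simp: symcl_def)
    then show ?case
      using step.IH by simp
  qed simp
qed

text \<open>
  Cops and robber: a bag of at most \<open>c\<close> vertices leaves a colour \<open>r\<close> free for the robber, who
  absorbs the odd degree. Between adjacent bags he moves avoiding their intersection, which does
  not affect the degrees there. If the intersection blocks the way, then it is a full side, both
  bags have the same colours, and he stays put.
\<close>

lemma untwisting:
  fixes F :: "nat pair_pre_digraph"
  assumes F: "pair_graph F" "treewidth F < c" and ck: "2 * c \<le> k"
    and p: "\<And>a. a \<in> pverts F \<Longrightarrow> p a < k"
  shows "\<exists>z. (\<forall>a\<in>pverts F. z a \<subseteq> nbrs c k (p a) \<and> (odd (card (z a)) \<longleftrightarrow> p a = 0)) \<and>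
    (\<forall>(a, b)\<in>parcs F. p b \<in> z a \<longleftrightarrow> p a \<in> z b)"
proof -
  obtain T :: "nat pair_pre_digraph" and B
    where dec: "tree_decomposition F T B" and width: "decomposition_width T B = treewidth F"
    using treewidth_decomposition[OF F(1)] by blast
  have T: "undirected_tree T" and B: "(\<Union>t\<in>pverts T. B t) = pverts F"
    and arcs: "\<And>a b. (a, b) \<in> parcs F \<Longrightarrow> \<exists>t\<in>pverts T. a \<in> B t \<and> b \<in> B t"
    and conn: "\<And>a. a \<in> pverts F \<Longrightarrow> connected (with_proj T \<restriction> {t \<in> pverts T. a \<in> B t})"
    using dec by (auto simp: tree_decomposition_def)
  \<comment> \<open>As no bag has more than \<open>c\<close> colours, the colours of a bag contain a
    full side only by being equal to it.\<close>
  have side: "c \<le> card (nbrs c k v)" for v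
  proof -
    have "nbrs c k v = (if v < c then {c..<k} else {..<c})"
      using ck by (auto simp: nbrs_def)
    then show ?thesis
      using ck by auto
  qed
  have ck': "0 < c" "c < k"
    using F(2) ck by auto
  have bag: "finite (B t)" "card (p ` B t) \<le> c" if t: "t \<in> pverts T" for t
  proof -
    have sub: "B t \<subseteq> pverts F"
      using B t by blast
    then show fin: "finite (B t)"
      using pair_graphD(1)[OF F(1)] finite_subset by blast
    have "card (B t) \<le> Max ((\<lambda>t. card (B t)) ` pverts T)"
      using t undirected_treeD(3)[OF T] by (intro Max_ge) auto
    \<comment> \<open>The width is one less than the largest bag size, so the strict bound on it
      allows bags of size \<open>c\<close>.\<close>
    then have "card (B t) \<le> c"
      using width F(2) unfolding decomposition_width_def by linarith
    then show "card (p ` B t) \<le> c"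
      using card_image_le[OF fin, of p] by simp
  qed
  \<comment> \<open>The robber depends on the set of colours alone, so bags with the same colours
    have the same robber; \<open>stay\<close> rests on this.\<close>
  define rob where "rob Y = (SOME r. r < k \<and> r \<notin> Y)" for Y :: "nat set"
  have rob: "rob (p ` B t) < k" "rob (p ` B t) \<notin> p ` B t" if "t \<in> pverts T" for t
  proof -
    have "card (p ` B t) < card {..<k}"
      using bag(2)[OF that] ck' by simp
    then have "\<not> {..<k} \<subseteq> p ` B t"
      using bag(1)[OF that] by (meson card_mono finite_imageI not_less)
    then have "\<exists>r. r < k \<and> r \<notin> p ` B t"
      by auto
    then show "rob (p ` B t) < k" "rob (p ` B t) \<notin> p ` B t"
      unfolding rob_def by (metis (mono_tags, lifting) someI_ex)+
  qed
  define P where "P t Q \<longleftrightarrow> t \<in> pverts T \<and> join_graph c k (rob (p ` B t)) Q" for t Q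
  define R where "R t t' Q Q' \<longleftrightarrow> (\<forall>v\<in>p ` (B t \<inter> B t'). Q v = Q' v)"
    for t t' and Q Q' :: "nat \<Rightarrow> nat set"
  have "\<exists>f. (\<forall>t\<in>pverts T. P t (f t)) \<and> (\<forall>(t, t')\<in>parcs T. R t t' (f t) (f t'))"
  proof (rule tree_choice[OF T])
    fix t assume t: "t \<in> pverts T"
    \<comment> \<open>With \<open>r = 0\<close> the two exceptions cancel and the empty graph
      qualifies; nothing is to be avoided yet when moving from there to the robber.\<close>
    have "join_graph c k 0 (\<lambda>_. {})"
      by (simp add: join_graph_def)
    moreover have "\<not> nbrs c k 0 \<subseteq> {}"
      using side[of 0] ck' by auto
    ultimately show "\<exists>Q. P t Q"
      using join_graph_move[of c k 0 _ "{}" "rob (p ` B t)"] rob[OF t] t ck' unfolding P_def by auto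
  next
    fix t t' Q assume tt': "(t, t') \<in> parcs T" and Q: "P t Q"
    have t: "t \<in> pverts T" "t' \<in> pverts T"
      using pair_graphD(2)[OF undirected_treeD(1)[OF T]] tt' by auto
    let ?Y = "p ` (B t \<inter> B t')"
    have stay: "rob (p ` B t') = rob (p ` B t)" if Y: "nbrs c k (rob (p ` B t)) \<subseteq> ?Y"
    proof -
      have "nbrs c k (rob (p ` B t)) = p ` B s" if "s \<in> {t, t'}" for s
      proof (rule card_seteq)
        show "finite (p ` B s)" "nbrs c k (rob (p ` B t)) \<subseteq> p ` B s"
          using that t bag(1) Y by auto
        show "card (p ` B s) \<le> card (nbrs c k (rob (p ` B t)))"
          using that t bag(2)[of s] side[of "rob (p ` B t)"] by auto
      qed
      then show ?thesis
        by (metis insertCI)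
    qed
    have "\<exists>Q'. join_graph c k (rob (p ` B t')) Q' \<and> (\<forall>v\<in>?Y. Q v = Q' v)"
    proof (rule join_graph_move)
      show "join_graph c k (rob (p ` B t)) Q"
        using Q by (simp add: P_def)
      show "rob (p ` B t) \<notin> ?Y" "rob (p ` B t') \<notin> ?Y"
        using rob(2)[OF t(1)] rob(2)[OF t(2)] by auto
    qed (use rob(1) t stay in auto)
    then show "\<exists>Q'. P t' Q' \<and> R t t' Q Q'"
      using t by (auto simp: P_def R_def)
  next
    show "R t' t Q' Q" if "R t t' Q Q'" for t t' Q Q'
      using that by (auto simp: R_def)
  qed
  then obtain f where f: "\<And>t. t \<in> pverts T \<Longrightarrow> join_graph c k (rob (p ` B t)) (f t)"
    and fR: "\<And>t t'. (t, t') \<in> parcs T \<Longrightarrow> R t t' (f t) (f t')"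
    unfolding P_def by blast
  have "\<forall>a\<in>pverts F. \<exists>t. t \<in> pverts T \<and> a \<in> B t"
    using B by blast
  then obtain \<tau> where \<tau>: "\<And>a. a \<in> pverts F \<Longrightarrow> \<tau> a \<in> pverts T \<and> a \<in> B (\<tau> a)"
    by metis
  \<comment> \<open>The nodes whose bags contain \<open>a\<close> are connected in the tree, and
    along them \<open>R\<close> keeps the neighbourhood of \<open>p a\<close> fixed.\<close>
  have indep: "f (\<tau> a) (p a) = f t (p a)" if a: "a \<in> pverts F" and t: "t \<in> pverts T" "a \<in> B t" for a t
  proof (rule connected_induced_invariant[OF conn[OF a], where f = "\<lambda>t. f t (p a)"])
    show "f t (p a) = f t' (p a)"
      if "(t, t') \<in> parcs T" "t \<in> {t \<in> pverts T. a \<in> B t}" "t' \<in> {t \<in> pverts T. a \<in> B t}" for t t'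
      using fR[OF that(1)] that by (auto simp: R_def)
  qed (use \<tau>[OF a] t in auto)
  define z where "z a = f (\<tau> a) (p a)" for a
  have "z a \<subseteq> nbrs c k (p a) \<and> (odd (card (z a)) \<longleftrightarrow> p a = 0)" if a: "a \<in> pverts F" for a
  proof -
    \<comment> \<open>The robber is outside the bag of \<open>a\<close>, so at \<open>p a\<close>
      the degree is odd only for colour \<open>0\<close>.\<close>
    have "p a \<noteq> rob (p ` B (\<tau> a))"
      using \<tau>[OF a] rob(2)[of "\<tau> a"] by (metis imageI)
    then show ?thesis
      using f[of "\<tau> a"] \<tau>[OF a] p[OF a] by (simp add: join_graph_def z_def)
  qed
  moreover have "p b \<in> z a \<longleftrightarrow> p a \<in> z b" if ab: "(a, b) \<in> parcs F" for a b
  proof -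
    have V: "a \<in> pverts F" "b \<in> pverts F"
      using pair_graphD(2)[OF F(1)] ab by auto
    obtain t where t: "t \<in> pverts T" "a \<in> B t" "b \<in> B t"
      using arcs[OF ab] by blast
    have "z a = f t (p a)" "z b = f t (p b)"
      using indep V t by (auto simp: z_def)
    then show ?thesis
      using f[OF t(1)] p[OF V(1)] p[OF V(2)] by (simp add: join_graph_def)
  qed
  ultimately show ?thesis
    by blast
qed

section \<open>Equality of the homomorphism counts\<close>

text \<open>Adding the sets from \<open>untwisting\<close> to the labels modulo 2 flips the parity
  exactly at colour \<open>0\<close>. On adjacent vertices it toggles both memberships of their base
  edge or neither, so adjacency survives. Colours are kept, so the same sets undo the
  change.\<close>

lemma hom_count_cfi_eq:
  fixes F :: "nat pair_pre_digraph"
  assumes F: "pair_graph F" "treewidth F < c" and ck: "2 * c \<le> k" and W: "W \<subseteq> {..<k}"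
  shows "hom_count F (cfi c k False W) = hom_count F (cfi c k True W)"
proof -
  let ?V = "pverts F"
  define good where "good p z \<longleftrightarrow>
      (\<forall>a\<in>?V. z a \<subseteq> nbrs c k (p a) \<and> (odd (card (z a)) \<longleftrightarrow> p a = 0)) \<and>
      (\<forall>(a, b)\<in>parcs F. p b \<in> z a \<longleftrightarrow> p a \<in> z b)" for p z
  \<comment> \<open>The choice depends on the colouring only, so that \<open>\<Phi>\<close> is its
    own inverse.\<close>
  define Z where "Z p = (SOME z. good p z)" for p
  have Z: "good p (Z p)" if "\<And>a. a \<in> ?V \<Longrightarrow> p a < k" for p
    using untwisting[OF F ck that] unfolding Z_def good_def by (rule someI_ex)
  define \<Phi> where "\<Phi> h = (\<lambda>a\<in>?V. vert (colour (h a)) (sym_diff (label (h a)) (Z (\<lambda>a. colour (h a)) a)))"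
    for h :: "nat \<Rightarrow> nat"
  have \<Phi>: "\<Phi> h \<in> graph_homs F (cfi c k (\<not> b) W)" "\<Phi> (\<Phi> h) = h"
    if h: "h \<in> graph_homs F (cfi c k b W)" for h b
  proof -
    define p where "p = (\<lambda>a. colour (h a))"
    have hV: "h a \<in> cfi_verts c k b W" if "a \<in> ?V" for a
      using h that by (auto simp: graph_homs_def cfi_def PiE_iff)
    have pW: "p a \<in> W" if "a \<in> ?V" for a
      using hV[OF that] by (simp add: p_def cfi_verts_def)
    then have "good p (Z p)"
      using W by (intro Z) auto
    note good = this[unfolded good_def]
    have z: "Z p a \<subseteq> nbrs c k (p a)" "odd (card (Z p a)) \<longleftrightarrow> p a = 0" if "a \<in> ?V" for a
      using good that by blast+
    have zs: "p a' \<in> Z p a \<longleftrightarrow> p a \<in> Z p a'" if "(a, a') \<in> parcs F" for a a'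
      using good that by blast
    have fin: "finite (Z p a)" if "a \<in> ?V" for a
      using z(1)[OF that] finite_nbrs finite_subset by blast
    have \<Phi>_app: "\<Phi> h a = vert (p a) (sym_diff (label (h a)) (Z p a))" if "a \<in> ?V" for a
      using that by (simp add: \<Phi>_def p_def)
    have col: "colour (\<Phi> h a) = p a" if "a \<in> ?V" for a
      using that by (simp add: \<Phi>_app)
    have lab: "label (\<Phi> h a) = sym_diff (label (h a)) (Z p a)" if "a \<in> ?V" for a
      using fin[OF that] that by (simp add: \<Phi>_app label_vert)
    have vert: "\<Phi> h a \<in> cfi_verts c k (\<not> b) W" if a: "a \<in> ?V" for a
    proof -
      have "odd (card (label (\<Phi> h a))) \<longleftrightarrow> (\<not> b) \<and> p a = 0"
        using odd_card_sym_diff[OF finite_label fin[OF a]] hV[OF a] z(2)[OF a]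
        unfolding lab[OF a] by (auto simp: cfi_verts_def p_def)
      moreover have "label (\<Phi> h a) \<subseteq> nbrs c k (p a)"
        using hV[OF a] z(1)[OF a] unfolding lab[OF a] by (auto simp: cfi_verts_def p_def)
      ultimately show ?thesis
        using pW[OF a] col[OF a] by (simp add: cfi_verts_def)
    qed
    have "(\<Phi> h a, \<Phi> h a') \<in> parcs (cfi c k (\<not> b) W)" if aa': "(a, a') \<in> parcs F" for a a'
    proof -
      have V: "a \<in> ?V" "a' \<in> ?V"
        using pair_graphD(2)[OF F(1)] aa' by auto
      have "(h a, h a') \<in> parcs (cfi c k b W)"
        using h aa' by (auto simp: graph_homs_def)
      then have "p a' \<in> nbrs c k (p a)" "p a' \<in> label (h a) \<longleftrightarrow> p a \<notin> label (h a')"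
        by (auto simp: cfi_def p_def)
      then show ?thesis
        using vert[OF V(1)] vert[OF V(2)] zs[OF aa'] V by (auto simp: cfi_def col lab)
    qed
    moreover have "\<Phi> h \<in> ?V \<rightarrow>\<^sub>E pverts (cfi c k (\<not> b) W)"
      using vert by (auto simp: \<Phi>_def cfi_def)
    ultimately show "\<Phi> h \<in> graph_homs F (cfi c k (\<not> b) W)"
      by (auto simp: graph_homs_def)
    \<comment> \<open>\<open>Z\<close> takes the colouring as a total function, so the colours must
      agree outside \<open>?V\<close> too; there both maps are \<open>undefined\<close>.\<close>
    have "colour (\<Phi> h a) = colour (h a)" for a
    proof (cases "a \<in> ?V")
      case False
      then have "h a = undefined"
        using h by (auto simp: graph_homs_def PiE_iff extensional_def)
      then show ?thesis
        using False by (simp add: \<Phi>_def)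
    qed (simp add: col p_def)
    then have p_eq: "(\<lambda>a. colour (\<Phi> h a)) = p"
      by (simp add: p_def)
    show "\<Phi> (\<Phi> h) = h"
    proof
      fix a
      show "\<Phi> (\<Phi> h) a = h a"
      proof (cases "a \<in> ?V")
        case True
        have "\<Phi> (\<Phi> h) a = vert (p a) (sym_diff (sym_diff (label (h a)) (Z p a)) (Z p a))"
          using True unfolding \<Phi>_def[of "\<Phi> h"] p_eq by (simp add: col lab)
        also have "sym_diff (sym_diff (label (h a)) (Z p a)) (Z p a) = label (h a)"
          by blast
        finally show ?thesis
          by (simp add: p_def vert_colour_label)
      next
        case False
        then show ?thesis
          using h by (auto simp: \<Phi>_def graph_homs_def PiE_iff extensional_def)
      qed
    qed
  qed
  have "bij_betw \<Phi> (graph_homs F (cfi c k False W)) (graph_homs F (cfi c k True W))"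
    using \<Phi>[where b = False] \<Phi>[where b = True] by (intro bij_betwI[where g = \<Phi>]) auto
  then show ?thesis
    by (simp add: hom_count_def bij_betw_same_card)
qed

theorem theorem7p5:
  fixes k :: nat
  assumes "k \<ge> 2"
  shows "WL_dimension (\<lambda>G. num_indsub (Phi_even k) G) = enat (k div 2)"
  unfolding WL_dimension_def
proof (rule antisym)
  show "Inf {enat d | d. d \<ge> 1 \<and> (\<forall>(G :: nat pair_pre_digraph) (G' :: nat pair_pre_digraph).
      pair_graph G \<longrightarrow> pair_graph G' \<longrightarrow>
      num_indsub (Phi_even k) G \<noteq> num_indsub (Phi_even k) G' \<longrightarrow> WL_distinguishes d G G')}
    \<le> enat (k div 2)"
  proof (rule Inf_lower, rule CollectI, rule exI[of _ "k div 2"], intro conjI allI impI)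
    \<comment> \<open>This is where \<open>k \<ge> 2\<close> enters the upper bound: the dimension
      ranges over positive numbers.\<close>
    show "1 \<le> k div 2"
      using assms by linarith
    show "enat (k div 2) = enat (k div 2)" ..
  next
    fix G G' :: "nat pair_pre_digraph"
    assume "pair_graph G" "pair_graph G'" "num_indsub (Phi_even k) G \<noteq> num_indsub (Phi_even k) G'"
    then show "WL_distinguishes (k div 2) G G'"
      using num_indsub_even_determined unfolding WL_distinguishes_def by blast
  qed
next
  show "enat (k div 2) \<le> Inf {enat d | d. d \<ge> 1 \<and> (\<forall>(G :: nat pair_pre_digraph) (G' :: nat pair_pre_digraph).
      pair_graph G \<longrightarrow> pair_graph G' \<longrightarrow>
      num_indsub (Phi_even k) G \<noteq> num_indsub (Phi_even k) G' \<longrightarrow> WL_distinguishes d G G')}"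
  proof (rule Inf_greatest, clarify)
    fix d :: nat
    assume dist: "\<forall>(G :: nat pair_pre_digraph) (G' :: nat pair_pre_digraph).
      pair_graph G \<longrightarrow> pair_graph G' \<longrightarrow>
      num_indsub (Phi_even k) G \<noteq> num_indsub (Phi_even k) G' \<longrightarrow> WL_distinguishes d G G'"
    let ?c = "k div 2"
    have c: "1 \<le> ?c" "?c \<le> k" "2 * ?c \<le> k"
      using assms by linarith+
    have "\<not> d < ?c"
    proof
      assume d: "d < ?c"
      obtain W where W: "W \<subseteq> {..<k}" and
        "num_indsub (Phi_even k) (cfi ?c k False W) \<noteq> num_indsub (Phi_even k) (cfi ?c k True W)"
        using num_indsub_cfi_differ[OF c(1,2)] by blast
      then obtain F :: "nat pair_pre_digraph" where F: "pair_graph F" "treewidth F \<le> d"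
        "hom_count F (cfi ?c k False W) \<noteq> hom_count F (cfi ?c k True W)"
        using dist pair_graph_cfi[OF W] unfolding WL_distinguishes_def by blast
      have "treewidth F < ?c"
        using F(2) d by simp
      then show False
        using hom_count_cfi_eq[OF F(1) _ c(3) W] F(3) by blast
    qed
    then show "enat ?c \<le> enat d"
      by simp
  qed
qed

end
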